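(* Let $(\mathcal R,\mu)$ be a $\sigma$-finite non-atomic measure space. (i) Let $Y$ be an r.i. space over $(\mathcal R,\mu)$ and $L(Y)$ its fundamental Orlicz space. Then either $Y\subset L(Y)$ and $L(Y)$ is the smallest Orlicz space containing $Y$, or $Y\not\subset L(Y)$ and no smallest Orlicz space containing $Y$ exists. (ii) Let $X$ be an r.i. space over $(\mathcal R,\mu)$ and $L(X)$ its fundamental Orlicz space. Then either $L(X)\subset X$ and $L(X)$ is the largest Orlicz space contained in $X$, or $L(X)\not\subset X$ and no largest Orlicz space contained in $X$ exists.
   Context: A function $A:[0,\infty]\to[0,\infty]$ is quasi-convex if it is left-continuous, not identically zero or infinity on $(0,\infty]$, $A(0)=0$, and $t\mapsto A(t)/t$ is non-decreasing on $(0,\infty)$; it is a Young function if moreover it is convex. The right-continuous inverse of $A$ is $A^{-1}(t)=\sup\{\tau\ge0: A(\tau)\le t\}$, and $A^{-1}_\#(t)=1/A^{-1}(1/t)$ for $t\in[0,\infty]$ (with $1/0=\infty$, $1/\infty=0$). For quasi-convex $A$, the Orlicz space $L^A(\mathcal R,\mu)$ is the set of measurable $f:\mathcal R\to[-\infty,\infty]$ with $\|f\|_{L^A}=\inf\{\lambda>0:\int_{\mathcal R}A(|f|/\lambda)\,d\mu\le1\}<\infty$. Every quasi-convex function yields the same space, with equivalent functional, as some Young function. For measurable $f$, $f_*(\lambda)=\mu(\{|f|>\lambda\})$ and $f^*(t)=\inf\{\lambda\ge0:f_*(\lambda)\le t\}$. An r.i. norm is a map $\rho$ from non-negative measurable functions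 on $\mathcal R$ to $[0,\infty]$ such that for all $f,g,f_n\ge0$ measurable and $\lambda\ge 0$: (P1) $\rho(f+g)\le\rho(f)+\rho(g)$, $\rho(\lambda f)=\lambda\rho(f)$, and $\rho(f)=0$ implies $f=0$ a.e.; (P2) $f\le g$ a.e. implies $\rho(f)\le\rho(g)$; (P3) $f_n\nearrow f$ a.e. implies $\rho(f_n)\nearrow\rho(f)$; (P4) $\rho(\chi_E)<\infty$ if $\mu(E)<\infty$; (P5) if $\mu(E)<\infty$, there is $C_E>0$ with $\int_E f\,d\mu\le C_E\,\rho(f)$; (P6) $f^*=g^*$ implies $\rho(f)=\rho(g)$. The associated r.i. space is $X=\{f \text{ measurable}:\|f\|_X:=\rho(|f|)<\infty\}$. R.i. spaces are considered equal if they are equal as sets (equivalently, they have equivalent norms); Orlicz spaces $L^A$ (with $A$ quasi-convex) are regarded as r.i. spaces after equivalent renorming. The fundamental function of $X$ is $\varphi_X(t)=\|\chi_E\|_X$ for any measurable $E$ with $\mu(E)=t$, $t\in[0,\mu(\mathcal R)]$, extended by $\varphi_X(t)=\varphi_X(\mu(\mathcal R))$ for $t\ge\mu(\mathcal R)$ if $\mu(\mathcal R)<\infty$. There is a unique quasi-convex $A$ with $A^{-1}_\#=\varphi_X$; the fundamental Orlicz space of $X$ is $L(X)=L^A(\mathcal R,\mu)$ for this $A$. "Smallest"/"largest" Orlicz space with a given property means the least/greatest element, with respect to set inclusion, of the family of Orlicz spaces over $(\mathcal R,\mu)$ having that property (the least/greatest element itself must have the property). *)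

theory Defs
  imports "HOL-Analysis.Analysis"
begin

section \<open>Quasi-convex functions\<close>

text \<open>For \<open>t = 0\<close> the filter \<open>at_left t\<close> on \<^typ>\<open>ennreal\<close> is trivial, so left-continuity is a
  condition on \<open>(0, \<infinity>]\<close> only.\<close>

definition quasi_convex :: "(ennreal \<Rightarrow> ennreal) \<Rightarrow> bool" where
  "quasi_convex A \<longleftrightarrow>
     (\<forall>t. continuous (at_left t) A) \<and>
     (\<exists>t>0. A t \<noteq> 0) \<and> (\<exists>t>0. A t \<noteq> \<infinity>) \<and>
     A 0 = 0 \<and>
     mono_on {0<..<\<infinity>} (\<lambda>t. A t / t)"

definition right_inverse :: "(ennreal \<Rightarrow> ennreal) \<Rightarrow> ennreal \<Rightarrow> ennreal" where
  "right_inverse A t = Sup {\<tau>. A \<tau> \<le> t}"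

text \<open>\<open>A\<^sup>-\<^sup>1\<^sub>#\<close>; division on \<^typ>\<open>ennreal\<close> satisfies \<open>1 / 0 = \<infinity>\<close> and \<open>1 / \<infinity> = 0\<close>.\<close>

definition inverse_sharp :: "(ennreal \<Rightarrow> ennreal) \<Rightarrow> ennreal \<Rightarrow> ennreal" where
  "inverse_sharp A t = 1 / right_inverse A (1 / t)"


section \<open>Orlicz spaces\<close>

definition nonatomic :: "'a measure \<Rightarrow> bool" where
  "nonatomic M \<longleftrightarrow>
     (\<forall>E\<in>sets M. 0 < emeasure M E \<longrightarrow>
        (\<exists>F\<in>sets M. F \<subseteq> E \<and> 0 < emeasure M F \<and> emeasure M F < emeasure M E))"

definition abs_fun :: "('a \<Rightarrow> ereal) \<Rightarrow> 'a \<Rightarrow> ennreal" where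
  "abs_fun f x = e2ennreal \<bar>f x\<bar>"

definition orlicz_norm :: "'a measure \<Rightarrow> (ennreal \<Rightarrow> ennreal) \<Rightarrow> ('a \<Rightarrow> ereal) \<Rightarrow> ennreal" where
  "orlicz_norm M A f =
     Inf {l. 0 < l \<and> l < \<infinity> \<and> (\<integral>\<^sup>+ x. A (abs_fun f x / l) \<partial>M) \<le> 1}"

definition orlicz_space :: "'a measure \<Rightarrow> (ennreal \<Rightarrow> ennreal) \<Rightarrow> ('a \<Rightarrow> ereal) set" where
  "orlicz_space M A = {f \<in> borel_measurable M. orlicz_norm M A f < \<infinity>}"

definition orlicz_spaces :: "'a measure \<Rightarrow> ('a \<Rightarrow> ereal) set set" where
  "orlicz_spaces M = {orlicz_space M A | A. quasi_convex A}"


section \<open>Rearrangement-invariant spaces\<close>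

text \<open>Only non-negative functions are rearranged below, so \<open>\<bar>f\<bar>\<close> is \<open>f\<close> here. Admitting
  \<open>\<lambda> = \<infinity>\<close> in the infimum does not change its value.\<close>

definition distribution_fun :: "'a measure \<Rightarrow> ('a \<Rightarrow> ennreal) \<Rightarrow> ennreal \<Rightarrow> ennreal" where
  "distribution_fun M f l = emeasure M {x \<in> space M. l < f x}"

definition rearrangement :: "'a measure \<Rightarrow> ('a \<Rightarrow> ennreal) \<Rightarrow> ennreal \<Rightarrow> ennreal" where
  "rearrangement M f t = Inf {l. distribution_fun M f l \<le> t}"

locale ri_norm =
  fixes M :: "'a measure" and \<rho> :: "('a \<Rightarrow> ennreal) \<Rightarrow> ennreal"
  assumes triangle:
      "\<lbrakk>f \<in> borel_measurable M; g \<in> borel_measurable M\<rbrakk>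
        \<Longrightarrow> \<rho> (\<lambda>x. f x + g x) \<le> \<rho> f + \<rho> g"
    and homogeneous:
      "\<lbrakk>f \<in> borel_measurable M; 0 \<le> c\<rbrakk>
        \<Longrightarrow> \<rho> (\<lambda>x. ennreal c * f x) = ennreal c * \<rho> f"
    and definite:
      "\<lbrakk>f \<in> borel_measurable M; \<rho> f = 0\<rbrakk> \<Longrightarrow> AE x in M. f x = 0"
    and monotone:
      "\<lbrakk>f \<in> borel_measurable M; g \<in> borel_measurable M; AE x in M. f x \<le> g x\<rbrakk>
        \<Longrightarrow> \<rho> f \<le> \<rho> g"
    and Fatou:
      "\<lbrakk>\<And>n. F n \<in> borel_measurable M; f \<in> borel_measurable M;
        AE x in M. incseq (\<lambda>n. F n x) \<and> (\<lambda>n. F n x) \<longlonglongrightarrow> f x\<rbrakk>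
        \<Longrightarrow> incseq (\<lambda>n. \<rho> (F n)) \<and> (\<lambda>n. \<rho> (F n)) \<longlonglongrightarrow> \<rho> f"
    and indicator_finite:
      "\<lbrakk>E \<in> sets M; emeasure M E < \<infinity>\<rbrakk> \<Longrightarrow> \<rho> (indicator E) < \<infinity>"
    and locally_integrable:
      "\<lbrakk>E \<in> sets M; emeasure M E < \<infinity>\<rbrakk>
        \<Longrightarrow> \<exists>C::real. 0 < C \<and> (\<forall>f\<in>borel_measurable M.
              (\<integral>\<^sup>+ x\<in>E. f x \<partial>M) \<le> ennreal C * \<rho> f)"
    and rearrangement_invariant:
      "\<lbrakk>f \<in> borel_measurable M; g \<in> borel_measurable M; rearrangement M f = rearrangement M g\<rbrakk>
        \<Longrightarrow> \<rho> f = \<rho> g"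

definition ri_space :: "'a measure \<Rightarrow> (('a \<Rightarrow> ennreal) \<Rightarrow> ennreal) \<Rightarrow> ('a \<Rightarrow> ereal) set" where
  "ri_space M \<rho> = {f \<in> borel_measurable M. \<rho> (abs_fun f) < \<infinity>}"

text \<open>By rearrangement invariance the choice of \<open>E\<close> is irrelevant, and on a \<open>\<sigma>\<close>-finite non-atomic
  space such an \<open>E\<close> exists for every \<open>t\<close>. The minimum with \<open>\<mu>(\<R>)\<close> is the extension of \<open>\<phi>\<close> by the
  constant \<open>\<phi>(\<mu>(\<R>))\<close> in the case of finite total measure.\<close>

definition fundamental_function ::
    "'a measure \<Rightarrow> (('a \<Rightarrow> ennreal) \<Rightarrow> ennreal) \<Rightarrow> ennreal \<Rightarrow> ennreal" where
  "fundamental_function M \<rho> t =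
     \<rho> (indicator (SOME E. E \<in> sets M \<and> emeasure M E = min t (emeasure M (space M))))"

text \<open>The quasi-convex \<open>A\<close> below exists and is unique unless \<open>M\<close> is a null measure; in that case
  \<open>orlicz_space M A = borel_measurable M\<close> for every \<open>A\<close>.\<close>

definition fundamental_orlicz_space ::
    "'a measure \<Rightarrow> (('a \<Rightarrow> ennreal) \<Rightarrow> ennreal) \<Rightarrow> ('a \<Rightarrow> ereal) set" where
  "fundamental_orlicz_space M \<rho> =
     orlicz_space M (THE A. quasi_convex A \<and> inverse_sharp A = fundamental_function M \<rho>)"


section \<open>Optimal Orlicz spaces\<close>

definition smallest_orlicz_space_containing ::
    "'a measure \<Rightarrow> ('a \<Rightarrow> ereal) set \<Rightarrow> ('a \<Rightarrow> ereal) set \<Rightarrow> bool" where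
  "smallest_orlicz_space_containing M Y L \<longleftrightarrow>
     L \<in> orlicz_spaces M \<and> Y \<subseteq> L \<and> (\<forall>L'\<in>orlicz_spaces M. Y \<subseteq> L' \<longrightarrow> L \<subseteq> L')"

definition largest_orlicz_space_contained_in ::
    "'a measure \<Rightarrow> ('a \<Rightarrow> ereal) set \<Rightarrow> ('a \<Rightarrow> ereal) set \<Rightarrow> bool" where
  "largest_orlicz_space_contained_in M X L \<longleftrightarrow>
     L \<in> orlicz_spaces M \<and> L \<subseteq> X \<and> (\<forall>L'\<in>orlicz_spaces M. L' \<subseteq> X \<longrightarrow> L' \<subseteq> L)"

end

theory Submission
  imports Defs
begin

text \<open>For a quasi-convex \<open>A\<close> put \<open>R\<^sub>A = right_inverse A\<close>; the fundamental function of \<open>L\<^sup>A\<close> is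
\<open>\<phi>\<^sub>A(t) = 1 / R\<^sub>A(1/t)\<close>. Two facts reduce the theorem to a comparison of fundamental functions.

\<^item> An Orlicz space is determined by its fundamental function: if \<open>\<phi>\<^sub>B \<le> C \<phi>\<^sub>A\<close> at all finite
  \<open>t \<le> \<mu>(\<R>)\<close>, then \<open>L\<^sup>A \<subseteq> L\<^sup>B\<close> (\<open>orlicz_space_subset_if_dominates\<close>).
\<^item> For two spaces, each an Orlicz space or a rearrangement-invariant space, an inclusion \<open>Z \<subseteq> Z'\<close>
  forces \<open>\<phi>\<^sub>Z\<^sub>' \<le> C \<phi>\<^sub>Z\<close> (\<open>fundamental_dominates_if_subset\<close>): otherwise a gliding hump, the
  supremum of \<open>2\<^sup>-\<^sup>n \<chi>\<^sub>E / \<phi>\<^sub>Z(\<mu> E)\<close> over a sequence of sets \<open>E\<close> at which the ratio of the two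
  functions explodes, lies in \<open>Z\<close> and not in \<open>Z'\<close>.

Let \<open>Y\<close> be the fundamental Young function of the given space \<open>X\<close>, so that \<open>\<phi>\<^sub>Y = \<phi>\<close>. If
\<open>X \<subseteq> L\<^sup>Y\<close>, every Orlicz space containing \<open>X\<close> has a fundamental function bounded by a multiple of
\<open>\<phi>\<close> and hence contains \<open>L\<^sup>Y\<close>; the case \<open>L\<^sup>Y \<subseteq> X\<close> is the same with all inclusions reversed.

If \<open>X\<close> is not contained in \<open>L\<^sup>Y\<close> but in some \<open>L\<^sup>A\<close>, then \<open>\<phi> \<le> C \<phi>\<^sub>A\<close> is impossible, for it
would give \<open>X \<subseteq> L\<^sup>A \<subseteq> L\<^sup>Y\<close>. So there are \<open>t\<^sub>n\<close> with \<open>\<phi>(t\<^sub>n) > K\<^sub>n\<^sup>2 \<phi>\<^sub>A(t\<^sub>n)\<close>, where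
\<open>K\<^sub>n = 2\<^sup>n\<^sup>+\<^sup>1\<close>, and \<open>L\<^sup>A\<close> is not smallest: with \<open>c\<^sub>n = K\<^sub>n / \<phi>(t\<^sub>n)\<close>,
the function \<open>B(\<tau>) = A(\<tau>) + \<Sum>\<^sub>n \<tau> / (t\<^sub>n c\<^sub>n) \<chi>(c\<^sub>n < \<tau>)\<close>, made left-continuous,
has \<open>\<phi>\<^sub>B(t\<^sub>n) \<ge> \<phi>(t\<^sub>n) / K\<^sub>n > K\<^sub>n \<phi>\<^sub>A(t\<^sub>n)\<close>, so that \<open>L\<^sup>A\<close> is not contained in \<open>L\<^sup>B\<close>, and yet
\<open>X \<subseteq> L\<^sup>B\<close>. Indeed a function \<open>g\<close> with \<open>\<rho>(g) \<le> 1\<close> exceeds \<open>c\<^sub>n\<close> only on a set of measure at most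
\<open>t\<^sub>n\<close>, and the Hoelder-type inequality \<open>\<phi>(\<mu> E) \<integral>\<^sub>E g \<le> \<mu>(E) \<rho>(g)\<close> makes the \<open>n\<close>-th added term
contribute at most \<open>1 / K\<^sub>n\<close> to the modular (\<open>integral_large_values_le\<close>).

The construction for the second part is dual. If \<open>L\<^sup>A \<subseteq> X\<close> and \<open>\<phi>\<^sub>A(t\<^sub>n) > K\<^sub>n\<^sup>2 \<phi>(t\<^sub>n)\<close>, put
\<open>d\<^sub>n = 1 / (K\<^sub>n \<phi>(t\<^sub>n))\<close>, let \<open>G\<^sub>n(\<tau>) = \<tau> / (d\<^sub>n t\<^sub>n)\<close> for \<open>\<tau> \<le> d\<^sub>n\<close> and \<open>\<infinity>\<close> beyond, and take
for \<open>B\<close> the infimum of \<open>A\<close> and all \<open>G\<^sub>n\<close>, again made left-continuous. A function whose \<open>B\<close>-modular is finite splits into a part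
in \<open>L\<^sup>A\<close> and parts \<open>f\<^sub>n \<le> d\<^sub>n\<close> with \<open>\<integral> f\<^sub>n \<le> H d\<^sub>n t\<^sub>n\<close>, and \<open>\<rho>(f\<^sub>n) \<le> (1 + H) d\<^sub>n \<phi>(t\<^sub>n)\<close>
is summable because functions with values in \<open>[0, 1]\<close> satisfy
\<open>\<rho>(g) \<le> \<phi>(T) (1 + \<integral> g / T)\<close> (\<open>norm_le_fundamental_affine\<close>).

Both inequalities for \<open>\<rho>\<close> rest on rearrangement invariance. The first averages a step function over
cyclic permutations of its pieces, which requires cutting a non-atomic set into pieces of equal measure
along the level sets of a function; the second expands \<open>g\<close> into binary digits.\<close>

section \<open>Reciprocals and geometric series of extended non-negative reals\<close>

lemma ennreal_mult_divide_cancel: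
  fixes u x :: ennreal
  assumes "0 < u" "u < \<infinity>"
  shows "u * (x / u) = x"
  using assms by (simp add: ennreal_times_divide mult.commute[of u] mult_divide_eq_ennreal)

lemma one_divide_le_iff_ennreal:
  fixes a b :: ennreal
  shows "1 / a \<le> b \<longleftrightarrow> 1 / b \<le> a"
proof -
  have "1 / y \<le> x" if "1 / x \<le> y" for x y :: ennreal
  proof (cases "x = 0 \<or> x = \<infinity>")
    case True
    then show ?thesis using that by (auto simp: top_unique)
  next
    case False
    then have "1 = x * (1 / x)"
      by (subst ennreal_mult_divide_cancel) (auto simp: zero_less_iff_neq_zero less_top)
    also have "\<dots> \<le> x * y"
      by (rule mult_left_mono[OF that]) simp
    finally have "1 \<le> x * y" .
    moreover from this have "0 < y"
      by (auto simp: zero_less_iff_neq_zero)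
    ultimately show ?thesis
      by (intro divide_le_posI_ennreal) (auto simp: mult.commute)
  qed
  then show ?thesis by blast
qed

lemma le_one_divide_iff_ennreal:
  fixes a b :: ennreal
  shows "a \<le> 1 / b \<longleftrightarrow> b \<le> 1 / a"
  using one_divide_le_iff_ennreal[of "1 / a" "1 / b"] by simp

lemma one_divide_antimono_ennreal:
  fixes a b :: ennreal
  shows "a \<le> b \<Longrightarrow> 1 / b \<le> 1 / a"
  using le_one_divide_iff_ennreal[of "1 / b" a] by simp

lemma one_divide_pos_finite:
  fixes t :: ennreal
  assumes "0 < t" "t < \<infinity>"
  shows "0 < 1 / t" "1 / t < \<infinity>"
  using assms by (auto simp: ennreal_zero_less_divide less_top[symmetric] ennreal_divide_eq_top_iff)

lemma ennreal_le_if_le_add_divide: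
  fixes x y z :: ennreal
  assumes z: "z < \<infinity>" and le: "\<And>q::nat. 0 < q \<Longrightarrow> x \<le> y + z / of_nat q"
  shows "x \<le> y"
proof (rule ennreal_le_epsilon)
  fix e :: real assume e: "0 < e"
  obtain c where c: "z = ennreal c" "0 \<le> c"
    using z by (cases z) auto
  obtain q :: nat where q: "c / e < of_nat q"
    using reals_Archimedean2 by blast
  have "0 < q"
    using q c e by (cases q) (auto simp: divide_less_0_iff)
  then have "z / of_nat q = ennreal (c / of_nat q)"
    using c by (simp add: ennreal_of_nat_eq_real_of_nat divide_ennreal)
  also have "\<dots> \<le> ennreal e"
    using q e \<open>0 < q\<close> by (intro ennreal_leI) (auto simp: field_simps)
  finally show "x \<le> y + ennreal e"
    using le[OF \<open>0 < q\<close>] by (meson add_left_mono order_trans)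
qed

lemma suminf_half_powers: "(\<Sum>n. ennreal ((1/2) ^ Suc n)) = 1"
proof -
  have "(\<Sum>n. ennreal ((1/2) ^ Suc n)) = ennreal 1"
    by (rule suminf_ennreal_eq[OF _ power_half_series]) simp
  then show ?thesis
    by (simp only: ennreal_1)
qed

lemma suminf_inverse_powers_of_two: "(\<Sum>n. 1 / ennreal (2 ^ Suc n)) = 1"
proof -
  have "1 / ennreal (2 ^ Suc n) = ennreal ((1/2) ^ Suc n)" for n
    by (simp add: divide_ennreal_def inverse_ennreal power_one_over inverse_eq_divide del: power_Suc)
  then show ?thesis using suminf_half_powers by simp
qed

lemma powers_of_two_unbounded_ennreal:
  assumes C: "C < \<infinity>" and le: "\<And>n. ennreal (2 ^ n) \<le> C"
  shows False
proof -
  obtain c where c: "C = ennreal c" "0 \<le> c" using C by (cases C) auto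
  obtain n where "c < 2 ^ n"
    using real_arch_pow[of 2 c] by auto
  then show False using le[of n] c by simp
qed

text \<open>A lower set of extended non-negative reals is an interval with left end \<open>0\<close>, closed or
half-open according to whether it contains its supremum.\<close>

lemma ennreal_lowerset_measurable:
  fixes A :: "ennreal set"
  assumes "\<And>x y. y \<in> A \<Longrightarrow> x \<le> y \<Longrightarrow> x \<in> A"
  shows "A \<in> sets borel"
proof (cases "Sup A \<in> A")
  case True
  then have "A = {..Sup A}" using assms by (auto intro: Sup_upper)
  then show ?thesis by (metis atMost_borel)
next
  case False
  have "A = {..<Sup A}"
    using assms False by (auto simp: less_Sup_iff intro: order.strict_implies_order)
      (metis Sup_upper order.not_eq_order_implies_strict less_Sup_iff)
  then show ?thesis by (metis lessThan_borel)
qed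

lemma mono_ennreal_measurable:
  fixes A :: "ennreal \<Rightarrow> ennreal"
  assumes "mono A"
  shows "A \<in> borel_measurable borel"
proof (rule borel_measurableI_le)
  fix y
  show "{x \<in> space borel. A x \<le> y} \<in> sets borel"
    using assms by (intro ennreal_lowerset_measurable) (auto simp: mono_def intro: order_trans)
qed

section \<open>Quasi-convex functions\<close>

text \<open>Together with left-continuity this is the form in which quasi-convexity is used: unlike monotonicity of
\<open>A(t) / t\<close> it involves no division, and it is inherited by sums, infima and left regularizations.\<close>

definition star_shaped :: "(ennreal \<Rightarrow> ennreal) \<Rightarrow> bool" where
  "star_shaped A \<longleftrightarrow> (\<forall>\<theta> t. \<theta> \<le> 1 \<longrightarrow> A (\<theta> * t) \<le> \<theta> * A t)"

lemma star_shapedD: "star_shaped A \<Longrightarrow> \<theta> \<le> 1 \<Longrightarrow> A (\<theta> * t) \<le> \<theta> * A t"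
  by (simp add: star_shaped_def)

lemma at_left_ennreal_nontrivial:
  fixes t :: ennreal
  assumes "0 < t"
  shows "at_left t \<noteq> bot"
proof
  assume "at_left t = bot"
  then have "eventually (\<lambda>_. False) (at_left t)"
    by simp
  then obtain b where "b < t" "\<forall>y>b. y < t \<longrightarrow> False"
    unfolding eventually_at_left[OF assms] by blast
  then show False
    using dense[OF \<open>b < t\<close>] by blast
qed

lemma quasi_convex_zero: "quasi_convex A \<Longrightarrow> A 0 = 0"
  by (simp add: quasi_convex_def)

lemma quasi_convex_tendsto: "quasi_convex A \<Longrightarrow> (A \<longlongrightarrow> A t) (at_left t)"
  by (simp add: quasi_convex_def continuous_within)

lemma quasi_convex_scale_finite:
  assumes A: "quasi_convex A" and \<theta>: "\<theta> \<le> 1" and t: "t < \<infinity>"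
  shows "A (\<theta> * t) \<le> \<theta> * A t"
proof (cases "\<theta> = 0 \<or> t = 0")
  case True
  then show ?thesis
    using quasi_convex_zero[OF A] by auto
next
  case False
  have le: "\<theta> * t \<le> t"
    using mult_right_mono[OF \<theta>, of t] by simp
  have pos: "0 < \<theta> * t"
    using False by (simp add: zero_less_iff_neq_zero)
  have "A (\<theta> * t) / (\<theta> * t) \<le> A t / t"
    using A le pos t False unfolding quasi_convex_def mono_on_def
    by (auto simp: zero_less_iff_neq_zero intro: le_less_trans)
  then have "(\<theta> * t) * (A (\<theta> * t) / (\<theta> * t)) \<le> (\<theta> * t) * (A t / t)"
    by (rule mult_left_mono) simp
  moreover have "(\<theta> * t) * (A (\<theta> * t) / (\<theta> * t)) = A (\<theta> * t)"
    using pos le_less_trans[OF le t] by (intro ennreal_mult_divide_cancel) auto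
  moreover have "(\<theta> * t) * (A t / t) = \<theta> * A t"
    using False t by (subst mult.assoc, subst ennreal_mult_divide_cancel) (auto simp: zero_less_iff_neq_zero)
  ultimately show ?thesis
    by simp
qed

lemma quasi_convex_mono:
  assumes A: "quasi_convex A" and st: "s \<le> t"
  shows "A s \<le> A t"
proof -
  have fin: "A s \<le> A t" if "s \<le> t" "t < \<infinity>" for s t
  proof (cases "t = 0")
    case True
    then show ?thesis using that by simp
  next
    case False
    have "s / t \<le> 1"
      using that False by (intro divide_le_posI_ennreal) (auto simp: zero_less_iff_neq_zero)
    moreover have "s / t * t = s"
      using that False by (simp add: ennreal_divide_times)
    ultimately have "A s \<le> s / t * A t"
      using quasi_convex_scale_finite[OF A, of "s / t" t] that by simp
    also have "\<dots> \<le> A t"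
      using mult_right_mono[OF \<open>s / t \<le> 1\<close>, of "A t"] by simp
    finally show ?thesis .
  qed
  show ?thesis
  proof (cases "t = \<infinity> \<and> s < \<infinity>")
    case True
    have "0 < t" using True by simp
    have "\<forall>\<^sub>F x in at_left t. A s \<le> A x"
      unfolding eventually_at_left[OF \<open>0 < t\<close>]
      using True fin by (intro exI[of _ s]) (auto intro!: fin)
    then show ?thesis
      using tendsto_lowerbound[OF quasi_convex_tendsto[OF A]] at_left_ennreal_nontrivial[OF \<open>0 < t\<close>]
      by blast
  next
    case False
    then show ?thesis
      using fin st by (cases "t < \<infinity>") (auto simp: less_top[symmetric])
  qed
qed

lemma quasi_convex_SUP:
  assumes A: "quasi_convex A" and t: "0 < t"
  shows "A t = (SUP s\<in>{..<t}. A s)"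
proof (rule antisym)
  have "\<forall>\<^sub>F x in at_left t. A x \<le> (SUP s\<in>{..<t}. A s)"
    unfolding eventually_at_left[OF t] using t by (intro exI[of _ 0]) (auto intro: SUP_upper)
  then show "A t \<le> (SUP s\<in>{..<t}. A s)"
    using tendsto_upperbound[OF quasi_convex_tendsto[OF A]] at_left_ennreal_nontrivial[OF t] by blast
  show "(SUP s\<in>{..<t}. A s) \<le> A t"
    by (auto intro!: SUP_least quasi_convex_mono[OF A])
qed

text \<open>Left-continuity as it is applied below: a strict lower bound for \<open>A t\<close> already holds
strictly to the left of \<open>t\<close>.\<close>

lemma quasi_convex_less:
  assumes A: "quasi_convex A" and "a < A t"
  shows "\<exists>s<t. a < A s"
proof -
  have "0 < t"
    using assms quasi_convex_zero[OF A] by (cases "t = 0") (auto simp: zero_less_iff_neq_zero)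
  then show ?thesis
    using quasi_convex_SUP[OF A] assms(2) by (auto simp: less_SUP_iff)
qed

lemma quasi_convex_finite_pos:
  assumes A: "quasi_convex A"
  shows "\<exists>t. t < \<infinity> \<and> 0 < A t"
proof -
  obtain t where "0 < A t"
    using A by (auto simp: quasi_convex_def zero_less_iff_neq_zero)
  then obtain s where "s < t" "0 < A s"
    using quasi_convex_less[OF A] by blast
  then show ?thesis
    by (metis infinity_ennreal_def less_top order_less_trans top.not_eq_extremum)
qed

text \<open>Being non-zero at some finite \<open>t\<close>, the function grows at least linearly from there on.\<close>

lemma quasi_convex_top:
  assumes A: "quasi_convex A"
  shows "A \<infinity> = \<infinity>"
proof (rule ccontr)
  assume ne: "A \<infinity> \<noteq> \<infinity>"
  obtain t where t: "t < \<infinity>" "0 < A t"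
    using quasi_convex_finite_pos[OF A] by blast
  obtain a where a: "A t = ennreal a" "0 < a"
    using t ne quasi_convex_mono[OF A, of t \<infinity>] by (cases "A t") (auto simp: top_unique)
  obtain c where c: "A \<infinity> = ennreal c" "0 \<le> c"
    using ne by (cases "A \<infinity>") auto
  have "a \<le> c"
    using quasi_convex_mono[OF A, of t \<infinity>] a c by simp
  obtain r where r: "t = ennreal r" "0 \<le> r"
    using t by (cases t) auto
  let ?\<theta> = "a / (2 * c)"
  have "ennreal ?\<theta> * ennreal (r / ?\<theta>) = t"
    using a c r \<open>a \<le> c\<close> by (simp flip: ennreal_mult)
  then have "A t \<le> ennreal ?\<theta> * A (ennreal (r / ?\<theta>))"
    using quasi_convex_scale_finite[OF A, of "ennreal ?\<theta>" "ennreal (r / ?\<theta>)"] a c \<open>a \<le> c\<close> by simp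
  also have "\<dots> \<le> ennreal ?\<theta> * A \<infinity>"
    by (intro mult_left_mono quasi_convex_mono[OF A]) auto
  also have "\<dots> = ennreal (a / 2)"
    using a c \<open>a \<le> c\<close> by (simp flip: ennreal_mult)
  finally show False
    using a by simp
qed

lemma quasi_convex_star_shaped:
  assumes A: "quasi_convex A"
  shows "star_shaped A"
  unfolding star_shaped_def
proof (intro allI impI)
  fix \<theta> t :: ennreal
  assume \<theta>: "\<theta> \<le> 1"
  show "A (\<theta> * t) \<le> \<theta> * A t"
  proof (cases "t = \<infinity> \<and> \<theta> \<noteq> 0")
    case True
    then show ?thesis
      using quasi_convex_top[OF A] by (simp add: ennreal_mult_top)
  next
    case False
    then show ?thesis
      using quasi_convex_scale_finite[OF A \<theta>] quasi_convex_zero[OF A] by (cases "\<theta> = 0") (auto simp: less_top)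
  qed
qed

lemma quasi_convexI:
  assumes star: "star_shaped A" and mono: "mono A"
    and left: "\<And>t. 0 < t \<Longrightarrow> A t \<le> (SUP s\<in>{..<t}. A s)"
    and nonzero: "A t1 \<noteq> 0" and finite: "0 < t2" "A t2 \<noteq> \<infinity>"
  shows "quasi_convex A"
proof -
  have zero: "A 0 = 0"
    using star_shapedD[OF star, of 0 0] by simp
  have "continuous (at_left t) A" for t
  proof (cases "t = 0")
    case True
    then show ?thesis
      using trivial_limit_at_left_bot[where 'a = ennreal] by (simp add: bot_ennreal)
  next
    case False
    then have t: "0 < t" by (simp add: zero_less_iff_neq_zero)
    show ?thesis
      unfolding continuous_within
    proof (rule order_tendstoI)
      fix a assume "a < A t"
      then obtain s where s: "s < t" "a < A s"
        using left[OF t] by (meson less_SUP_iff lessThan_iff less_le_trans)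
      then show "\<forall>\<^sub>F x in at_left t. a < A x"
        unfolding eventually_at_left[OF t]
        using mono by (auto intro!: exI[of _ s] simp: mono_def intro: less_le_trans)
    next
      fix a assume a: "A t < a"
      show "\<forall>\<^sub>F x in at_left t. A x < a"
        unfolding eventually_at_left[OF t]
        using t le_less_trans[OF monoD[OF mono] a] by (intro exI[of _ 0]) auto
    qed
  qed
  moreover have "mono_on {0<..<\<infinity>} (\<lambda>t. A t / t)"
  proof (rule mono_onI)
    fix s t :: ennreal
    assume s: "s \<in> {0<..<\<infinity>}" and t: "t \<in> {0<..<\<infinity>}" and st: "s \<le> t"
    have "s / t \<le> 1"
      using s t st by (intro divide_le_posI_ennreal) auto
    then have "A (s / t * t) \<le> s / t * A t"
      by (rule star_shapedD[OF star])
    moreover have "s / t * t = s"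
      using s t by (subst mult.commute) (auto intro!: ennreal_mult_divide_cancel)
    ultimately have "A s \<le> A t / t * s"
      by (simp add: ennreal_divide_times mult.commute ennreal_times_divide)
    then show "A s / s \<le> A t / t"
      using s by (intro divide_le_posI_ennreal) (auto simp: mult.commute)
  qed
  ultimately show ?thesis
    unfolding quasi_convex_def using zero nonzero finite
    by (metis zero_less_iff_neq_zero)
qed

lemma quasi_convex_ident: "quasi_convex (\<lambda>t. t)"
proof (rule quasi_convexI[where ?t1.0 = 1 and ?t2.0 = 1])
  show "t \<le> (SUP s\<in>{..<t}. s)" for t :: ennreal
    by (rule dense_le) (auto intro: Sup_upper)
qed (auto simp: star_shaped_def mono_def)

lemma quasi_convex_measurable:
  assumes "quasi_convex A"
  shows "A \<in> borel_measurable borel"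
  by (rule mono_ennreal_measurable) (auto simp: mono_def intro: quasi_convex_mono[OF assms])

text \<open>The Young functions constructed at the end are infinite sums and infima, whose left-continuity is not
automatic. Regularizing restores it without changing the Orlicz space, because the regularization of \<open>A\<close>
lies between \<open>A(t / 2)\<close> and \<open>A(t)\<close> for finite \<open>t\<close>.\<close>

definition left_regularization :: "(ennreal \<Rightarrow> ennreal) \<Rightarrow> ennreal \<Rightarrow> ennreal" where
  "left_regularization A t = (SUP s\<in>{..<t}. A s)"

lemma left_regularization_upper: "s < t \<Longrightarrow> A s \<le> left_regularization A t"
  unfolding left_regularization_def by (auto intro: SUP_upper)

lemma left_regularization_le: "mono A \<Longrightarrow> left_regularization A t \<le> A t"
  unfolding left_regularization_def by (auto intro!: SUP_least simp: mono_def)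

lemma quasi_convex_left_regularization:
  assumes star: "star_shaped A" and mono: "mono A"
    and nonzero: "t1 < \<infinity>" "A t1 \<noteq> 0" and finite: "0 < t2" "A t2 \<noteq> \<infinity>"
  shows "quasi_convex (left_regularization A)"
proof (rule quasi_convexI[where ?t1.0 = \<infinity> and ?t2.0 = t2])
  show "star_shaped (left_regularization A)"
    unfolding star_shaped_def
  proof (intro allI impI)
    fix \<theta> t :: ennreal
    assume \<theta>: "\<theta> \<le> 1"
    show "left_regularization A (\<theta> * t) \<le> \<theta> * left_regularization A t"
      unfolding left_regularization_def[of A "\<theta> * t"]
    proof (rule SUP_least)
      fix s assume "s \<in> {..<\<theta> * t}"
      then have s: "s < \<theta> * t" by simp
      then have "\<theta> \<noteq> 0" by (metis mult_zero_left not_less_zero)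
      have "\<theta> < \<infinity>" using \<theta> by (auto intro: le_less_trans)
      have eq: "\<theta> * (s / \<theta>) = s"
        using \<open>\<theta> \<noteq> 0\<close> \<open>\<theta> < \<infinity>\<close> by (simp add: ennreal_times_divide mult.commute[of \<theta>] mult_divide_eq_ennreal)
      have "s / \<theta> < t"
        using s \<open>\<theta> \<noteq> 0\<close> \<open>\<theta> < \<infinity>\<close> by (subst divide_less_ennreal) (auto simp: mult.commute)
      have "A s \<le> \<theta> * A (s / \<theta>)"
        using star_shapedD[OF star \<theta>, of "s / \<theta>"] eq by simp
      also have "\<dots> \<le> \<theta> * left_regularization A t"
        by (intro mult_left_mono left_regularization_upper \<open>s / \<theta> < t\<close>) simp
      finally show "A s \<le> \<theta> * left_regularization A t" .
    qed
  qed
  show "mono (left_regularization A)"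
    unfolding left_regularization_def mono_def by (auto intro!: SUP_subset_mono)
  show "left_regularization A t \<le> (SUP s\<in>{..<t}. left_regularization A s)" for t
    unfolding left_regularization_def[of A t]
  proof (rule SUP_least)
    fix s assume "s \<in> {..<t}"
    then obtain u where "s < u" "u < t"
      using dense by auto
    then show "A s \<le> (SUP s\<in>{..<t}. left_regularization A s)"
      by (auto intro!: SUP_upper2[of u] left_regularization_upper)
  qed
  show "left_regularization A \<infinity> \<noteq> 0"
    using left_regularization_upper[OF nonzero(1), of A] nonzero(2) by auto
  show "left_regularization A t2 \<noteq> \<infinity>"
    using left_regularization_le[OF mono, of t2] finite(2) by (auto simp: top_unique)
qed fact

section \<open>The right-continuous inverse\<close>

text \<open>By left-continuity the supremum that defines the right inverse is attained, so \<open>A\<close> and its right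
inverse form a Galois connection. All later facts on the right inverse come from this.\<close>

lemma le_right_inverse_iff:
  assumes A: "quasi_convex A"
  shows "\<tau> \<le> right_inverse A s \<longleftrightarrow> A \<tau> \<le> s"
proof
  assume \<tau>: "\<tau> \<le> right_inverse A s"
  show "A \<tau> \<le> s"
  proof (rule ccontr)
    assume "\<not> A \<tau> \<le> s"
    then obtain u where u: "u < \<tau>" "s < A u"
      using quasi_convex_less[OF A] by (auto simp: not_le)
    then have "u < Sup {\<tau>. A \<tau> \<le> s}"
      using \<tau> unfolding right_inverse_def by simp
    then obtain v where "u < v" "A v \<le> s"
      by (auto simp: less_Sup_iff)
    then show False
      using u quasi_convex_mono[OF A, of u v] by (auto dest: order.strict_implies_order)
  qed
next
  assume "A \<tau> \<le> s"
  then show "\<tau> \<le> right_inverse A s"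
    unfolding right_inverse_def by (auto intro: Sup_upper)
qed

text \<open>Star-shapedness makes \<open>A\<close> arbitrarily small near \<open>0\<close>: multiply a point where \<open>A\<close> is finite
by \<open>\<theta> = s / A t\<close>.\<close>

lemma right_inverse_pos:
  assumes A: "quasi_convex A" and s: "0 < s"
  shows "0 < right_inverse A s"
proof -
  obtain t where t: "0 < t" "A t \<noteq> \<infinity>"
    using A by (auto simp: quasi_convex_def)
  show ?thesis
  proof (cases "A t \<le> s")
    case True
    then show ?thesis
      using le_right_inverse_iff[OF A, of t s] t by (auto intro: less_le_trans)
  next
    case False
    let ?\<theta> = "s / A t"
    have \<theta>: "?\<theta> \<le> 1"
      using False s by (intro divide_le_posI_ennreal) auto
    have "A (?\<theta> * t) \<le> s"
      using star_shapedD[OF quasi_convex_star_shaped[OF A] \<theta>, of t] False t s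
      by (auto simp: ennreal_divide_times not_le less_top[symmetric])
    moreover have "0 < ?\<theta> * t"
      using s t by (simp add: ennreal_zero_less_mult_iff ennreal_zero_less_divide less_top)
    ultimately show ?thesis
      using le_right_inverse_iff[OF A] by (meson less_le_trans)
  qed
qed

lemma right_inverse_finite:
  assumes A: "quasi_convex A" and s: "s < \<infinity>"
  shows "right_inverse A s < \<infinity>"
  using le_right_inverse_iff[OF A, of \<infinity> s] quasi_convex_top[OF A] s
  by (auto simp: less_top top_unique)

lemma quasi_convex_eq_if_inverse_sharp_eq:
  assumes A: "quasi_convex A" and B: "quasi_convex B" and eq: "inverse_sharp A = inverse_sharp B"
  shows "A = B"
proof
  fix \<tau>
  have "right_inverse A s = right_inverse B s" for s
    using fun_cong[OF eq, of "1 / s"] unfolding inverse_sharp_def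
    by (metis one_divide_one_divide_ennreal)
  then have "A \<tau> \<le> s \<longleftrightarrow> B \<tau> \<le> s" for s
    using le_right_inverse_iff[OF A] le_right_inverse_iff[OF B] by metis
  then show "A \<tau> = B \<tau>"
    by (meson antisym order_refl)
qed

lemma quasi_convex_SUP_le_suminf:
  assumes A: "quasi_convex A"
  shows "A (SUP n. y n) \<le> (\<Sum>n. A (y n :: ennreal))"
  unfolding le_right_inverse_iff[OF A, symmetric]
proof (rule SUP_least)
  fix n
  have "A (y n) \<le> (\<Sum>n. A (y n))"
    using sum_le_suminf[of "\<lambda>n. A (y n)" "{n}"] by auto
  then show "y n \<le> right_inverse A (\<Sum>n. A (y n))"
    by (simp add: le_right_inverse_iff[OF A])
qed

section \<open>Inclusion of Orlicz spaces from comparison of fundamental functions\<close>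

lemma abs_fun_measurable [measurable]: "f \<in> borel_measurable M \<Longrightarrow> abs_fun f \<in> borel_measurable M"
  unfolding abs_fun_def[abs_def] by measurable

lemma abs_fun_enn2ereal [simp]: "abs_fun (\<lambda>x. enn2ereal (g x)) = g"
  by (auto simp: abs_fun_def fun_eq_iff)

lemma enn2ereal_comp_measurable: "g \<in> borel_measurable M \<Longrightarrow> (\<lambda>x. enn2ereal (g x)) \<in> borel_measurable M"
  by measurable

lemma orlicz_spaceD:
  assumes "f \<in> orlicz_space M A"
  shows "f \<in> borel_measurable M \<and> (\<exists>l. 0 < l \<and> l < \<infinity> \<and> (\<integral>\<^sup>+ x. A (abs_fun f x / l) \<partial>M) \<le> 1)"
  using assms unfolding orlicz_space_def orlicz_norm_def by (auto simp: Inf_less_iff)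

text \<open>The bound \<open>1\<close> on the modular may be replaced by any finite bound \<open>c\<close>: star-shapedness turns a
division of the argument by \<open>c \<ge> 1\<close> into a division of the modular by \<open>c\<close>.\<close>

lemma orlicz_spaceI:
  assumes A: "quasi_convex A" and f: "f \<in> borel_measurable M"
    and l: "0 < l" "l < \<infinity>" and fin: "(\<integral>\<^sup>+ x. A (abs_fun f x / l) \<partial>M) < \<infinity>"
  shows "f \<in> orlicz_space M A"
proof -
  note [measurable] = f quasi_convex_measurable[OF A]
  let ?I = "\<integral>\<^sup>+ x. A (abs_fun f x / l) \<partial>M"
  define c where "c = max 1 ?I"
  have c: "1 \<le> c" "c < \<infinity>" "?I \<le> c" "c \<noteq> 0"
    using fin by (auto simp: c_def max_def)
  have ic: "1 / c \<le> 1"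
    using c by (intro divide_le_posI_ennreal) (auto intro: less_le_trans[OF zero_less_one])
  have "abs_fun f x / (c * l) = 1 / c * (abs_fun f x / l)" for x
    using c l by (simp add: divide_ennreal_def ennreal_inverse_mult mult_ac)
  then have "(\<integral>\<^sup>+ x. A (abs_fun f x / (c * l)) \<partial>M) \<le> (\<integral>\<^sup>+ x. 1 / c * A (abs_fun f x / l) \<partial>M)"
    using star_shapedD[OF quasi_convex_star_shaped[OF A] ic] by (auto intro!: nn_integral_mono)
  also have "\<dots> = 1 / c * ?I"
    by (intro nn_integral_cmult) measurable
  also have "\<dots> \<le> 1 / c * c"
    using c by (intro mult_left_mono) auto
  also have "\<dots> = 1"
    using c by (simp add: ennreal_divide_times less_top[symmetric])
  finally have "orlicz_norm M A f \<le> c * l"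
    unfolding orlicz_norm_def using c l
    by (intro Inf_lower) (auto simp: ennreal_zero_less_mult_iff zero_less_iff_neq_zero ennreal_mult_less_top)
  also have "c * l < \<infinity>"
    using c l by (simp add: ennreal_mult_less_top)
  finally show ?thesis
    using f by (simp add: orlicz_space_def)
qed

text \<open>On a null measure space all integrals vanish, so no Orlicz norm exceeds \<open>1\<close>, whatever \<open>A\<close> is.\<close>

lemma orlicz_space_null:
  assumes m: "emeasure M (space M) = 0"
  shows "orlicz_space M A = borel_measurable M"
proof -
  have "(\<integral>\<^sup>+ x. g x \<partial>M) = 0" for g
    using nn_integral_null_set[of "space M" M g] m by (simp add: null_sets_def cong: nn_integral_cong)
  then have "orlicz_norm M A f \<le> 1" for f
    unfolding orlicz_norm_def by (intro Inf_lower) simp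
  then have "orlicz_norm M A f < \<infinity>" for f
    by (rule le_less_trans) simp
  then show ?thesis
    by (auto simp: orlicz_space_def)
qed

text \<open>As \<open>1 / right_inverse A (1 / t)\<close> is the fundamental function of the Orlicz space of \<open>A\<close>, this says
that the fundamental function of \<open>B\<close> is at most \<open>C\<close> times that of \<open>A\<close> on the measures that occur.
Stating it with right inverses avoids one reciprocal.\<close>

definition fundamental_dominates :: "'a measure \<Rightarrow> (ennreal \<Rightarrow> ennreal) \<Rightarrow> (ennreal \<Rightarrow> ennreal) \<Rightarrow> bool" where
  "fundamental_dominates M A B \<longleftrightarrow>
     (\<exists>C<\<infinity>. \<forall>t. 0 < t \<longrightarrow> t < \<infinity> \<longrightarrow> t \<le> emeasure M (space M) \<longrightarrow>
        right_inverse A (1 / t) \<le> C * right_inverse B (1 / t))"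

text \<open>The hypothesis yields \<open>B(\<tau> / C) \<le> A(\<tau>) + 1 / m\<close>, where \<open>m\<close> is the total measure: levels below
\<open>1 / m\<close> are not seen by the comparison and cost the additive term. This term has integral at most \<open>1\<close>,
and it vanishes when \<open>m = \<infinity>\<close>, so finite and infinite measure are treated alike.\<close>

lemma orlicz_space_subset_if_dominates:
  assumes A: "quasi_convex A" and B: "quasi_convex B" and le: "fundamental_dominates M A B"
  shows "orlicz_space M A \<subseteq> orlicz_space M B"
proof
  fix f assume "f \<in> orlicz_space M A"
  then obtain l where f[measurable]: "f \<in> borel_measurable M" and l: "0 < l" "l < \<infinity>"
    and int: "(\<integral>\<^sup>+ x. A (abs_fun f x / l) \<partial>M) \<le> 1"
    using orlicz_spaceD by blast
  define m where "m = emeasure M (space M)"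
  obtain C0 where C0: "C0 < \<infinity>" "\<And>t. 0 < t \<Longrightarrow> t < \<infinity> \<Longrightarrow> t \<le> m \<Longrightarrow>
      right_inverse A (1 / t) \<le> C0 * right_inverse B (1 / t)"
    using le unfolding fundamental_dominates_def m_def by blast
  define C where "C = max 1 C0"
  have C: "C < \<infinity>" "0 < C" "C0 \<le> C"
    using C0 by (auto simp: C_def max_def intro: less_le_trans[OF zero_less_one])
  note [measurable] = quasi_convex_measurable[OF A] quasi_convex_measurable[OF B]
  have key: "B (\<tau> / C) \<le> A \<tau> + 1 / m" for \<tau>
  proof (rule dense_ge)
    fix s assume s: "A \<tau> + 1 / m < s"
    show "B (\<tau> / C) \<le> s"
    proof (cases "s = \<infinity>")
      case False
      have "0 < s" using s by (metis not_less_zero zero_less_iff_neq_zero)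
      have "1 / m \<le> s" "A \<tau> \<le> s"
        using s by (auto intro: order_trans[OF _ order.strict_implies_order[OF s]] simp: add_increasing add_increasing2)
      have "\<tau> \<le> right_inverse A (1 / (1 / s))"
        using \<open>A \<tau> \<le> s\<close> by (simp add: le_right_inverse_iff[OF A])
      also have "\<dots> \<le> C0 * right_inverse B (1 / (1 / s))"
      proof (rule C0(2))
        show "0 < 1 / s" "1 / s < \<infinity>"
          using False \<open>0 < s\<close> by (auto simp: ennreal_zero_less_divide less_top[symmetric] ennreal_divide_eq_top_iff)
        show "1 / s \<le> m"
          using \<open>1 / m \<le> s\<close>
          by (simp add: one_divide_le_iff_ennreal)
      qed
      also have "\<dots> \<le> C * right_inverse B s"
        using C by (auto intro: mult_right_mono)
      finally have "\<tau> / C \<le> right_inverse B s"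
        using C by (intro divide_le_posI_ennreal) (auto simp: mult.commute)
      then show ?thesis
        by (simp add: le_right_inverse_iff[OF B])
    qed simp
  qed
  have "(\<integral>\<^sup>+ x. B (abs_fun f x / (l * C)) \<partial>M) \<le> (\<integral>\<^sup>+ x. A (abs_fun f x / l) + 1 / m \<partial>M)"
  proof (rule nn_integral_mono)
    fix x
    have "abs_fun f x / (l * C) = abs_fun f x / l / C"
      using C l by (simp add: divide_ennreal_def ennreal_inverse_mult mult_ac)
    then show "B (abs_fun f x / (l * C)) \<le> A (abs_fun f x / l) + 1 / m"
      using key by simp
  qed
  also have "\<dots> = (\<integral>\<^sup>+ x. A (abs_fun f x / l) \<partial>M) + 1 / m * m"
    by (subst nn_integral_add) (auto simp: m_def)
  also have "\<dots> \<le> 1 + 1"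
  proof (intro add_mono int)
    show "1 / m * m \<le> 1"
      by (cases "m = 0 \<or> m = \<infinity>") (auto simp: ennreal_divide_times less_top[symmetric])
  qed
  also have "\<dots> < \<infinity>"
    by simp
  finally show "f \<in> orlicz_space M B"
    using C l by (intro orlicz_spaceI[OF B, where l = "l * C"])
      (auto simp: ennreal_zero_less_mult_iff ennreal_mult_less_top)
qed

section \<open>Sets of prescribed measure in a non-atomic space\<close>

text \<open>Of a proper subset and its complement, one carries at most half of the measure.\<close>

lemma nonatomic_halving:
  assumes M: "nonatomic M" and E: "E \<in> sets M" "0 < emeasure M E" "emeasure M E < \<infinity>"
  shows "\<exists>F\<in>sets M. F \<subseteq> E \<and> 0 < emeasure M F \<and> emeasure M F \<le> emeasure M E / 2"
proof -
  obtain G where G: "G \<in> sets M" "G \<subseteq> E" "0 < emeasure M G" "emeasure M G < emeasure M E"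
    using M E unfolding nonatomic_def by blast
  have sum: "emeasure M G + emeasure M (E - G) = emeasure M E"
    using G E by (subst plus_emeasure) (auto simp: Un_absorb1)
  have pos: "0 < emeasure M (E - G)"
    using sum G by (auto simp: zero_less_iff_neq_zero)
  obtain g where g: "emeasure M G = ennreal g" "0 \<le> g"
    using G E by (cases "emeasure M G") auto
  obtain h where h: "emeasure M (E - G) = ennreal h" "0 \<le> h"
    using sum E by (cases "emeasure M (E - G)") auto
  have e: "emeasure M E / 2 = ennreal ((g + h) / 2)"
    using g h by (simp add: ennreal_divide_numeral flip: sum ennreal_plus)
  consider "g \<le> h" | "h \<le> g" by linarith
  then show ?thesis
  proof cases
    case 1
    then show ?thesis using G g h e by (intro bexI[of _ G]) (auto simp: ennreal_le_iff2)
  next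
    case 2
    then show ?thesis using G g h e pos E by (intro bexI[of _ "E - G"]) (auto simp: ennreal_le_iff2)
  qed
qed

lemma nonatomic_small_subset:
  assumes M: "nonatomic M" and E: "E \<in> sets M" "0 < emeasure M E" and e: "0 < e"
  shows "\<exists>F\<in>sets M. F \<subseteq> E \<and> 0 < emeasure M F \<and> emeasure M F \<le> e"
proof (cases "e = \<infinity>")
  case False
  obtain F0 where F0: "F0 \<in> sets M" "F0 \<subseteq> E" "0 < emeasure M F0" "emeasure M F0 < emeasure M E"
    using M E unfolding nonatomic_def by blast
  have "\<exists>F\<in>sets M. F \<subseteq> E \<and> 0 < emeasure M F \<and> emeasure M F \<le> emeasure M F0 / 2 ^ n" for n
  proof (induction n)
    case 0
    show ?case using F0 by (intro bexI[of _ F0]) (auto simp: divide_ennreal_def)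
  next
    case (Suc n)
    then obtain F where F: "F \<in> sets M" "F \<subseteq> E" "0 < emeasure M F" "emeasure M F \<le> emeasure M F0 / 2 ^ n"
      by blast
    have "(1::ennreal) \<le> 2 ^ n"
      by simp
    then have "emeasure M F0 \<le> emeasure M F0 * 2 ^ n"
      using mult_left_mono[of 1 "2 ^ n" "emeasure M F0"] by simp
    then have "emeasure M F0 / 2 ^ n \<le> emeasure M F0"
      using less_le_trans[OF zero_less_one \<open>(1::ennreal) \<le> 2 ^ n\<close>]
      by (intro divide_le_posI_ennreal) (simp_all add: mult.commute)
    then have "emeasure M F < \<infinity>"
      using F(4) F0(4) by (auto intro: le_less_trans less_le_trans simp: less_top[symmetric] top_unique)
    then obtain G where G: "G \<in> sets M" "G \<subseteq> F" "0 < emeasure M G" "emeasure M G \<le> emeasure M F / 2"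
      using nonatomic_halving[OF M] F by blast
    have "emeasure M F / 2 \<le> emeasure M F0 / 2 ^ n / 2"
      by (rule divide_right_mono_ennreal) (rule F)
    also have "\<dots> = emeasure M F0 / 2 ^ Suc n"
      by (simp add: divide_ennreal_def ennreal_inverse_mult power_less_top_ennreal mult_ac)
    finally show ?case
      using G F by (intro bexI[of _ G]) auto
  qed
  moreover have "\<exists>n. emeasure M F0 / 2 ^ n \<le> e"
  proof -
    obtain c where c: "emeasure M F0 = ennreal c" "0 \<le> c"
      using F0 by (cases "emeasure M F0") auto
    obtain d where d: "e = ennreal d" "0 < d"
      using False e by (cases e) auto
    obtain n where "c / d < 2 ^ n"
      using real_arch_pow[of 2 "c / d"] by auto
    then have "ennreal c \<le> ennreal (d * 2 ^ n)"
      using d by (intro ennreal_leI) (auto simp: field_simps)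
    then have "emeasure M F0 \<le> e * 2 ^ n"
      using c d by (simp add: ennreal_mult ennreal_power[symmetric])
    moreover have "(1::ennreal) \<le> 2 ^ n"
      by simp
    then have "(0::ennreal) < 2 ^ n"
      by (rule less_le_trans[OF zero_less_one])
    ultimately show ?thesis
      by (intro exI[of _ n] divide_le_posI_ennreal) (simp_all add: mult.commute)
  qed
  ultimately show ?thesis
    by (meson order_trans)
qed (use E in auto)

text \<open>Sierpinski's theorem. Subsets of the part of \<open>E\<close> not yet used are added greedily, in each step at
least half of the largest measure that still fits below \<open>s\<close>. If the union had measure less than \<open>s\<close>, a
small set of positive measure would fit in every step, and each step would add at least half of its
measure.\<close>

lemma nonatomic_subset_of_measure:
  assumes M: "nonatomic M" and E: "E \<in> sets M" and s: "s \<le> emeasure M E"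
  shows "\<exists>F\<in>sets M. F \<subseteq> E \<and> emeasure M F = s"
proof (cases "s = \<infinity>")
  case True
  then show ?thesis using E s by (auto simp: top_unique)
next
  case False
  (* The measures of sets that can be added to F without exceeding s. *)
  define room where "room F = {emeasure M G | G. G \<in> sets M \<and> G \<subseteq> E - F \<and> emeasure M F + emeasure M G \<le> s}" for F
  have step: "\<exists>F'. (F' \<in> sets M \<and> F' \<subseteq> E \<and> emeasure M F' \<le> s) \<and> F \<subseteq> F' \<and> Sup (room F) \<le> 2 * emeasure M (F' - F)"
    if F: "F \<in> sets M \<and> F \<subseteq> E \<and> emeasure M F \<le> s" for F
  proof (cases "Sup (room F) = 0")
    case True
    then show ?thesis using F by (intro exI[of _ F]) auto
  next
    case nz: False
    have "Sup (room F) \<le> s"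
      by (rule Sup_least) (auto simp: room_def intro: order_trans[rotated] add_increasing)
    then have fin: "Sup (room F) < \<infinity>"
      using False by (auto simp: less_top intro: le_less_trans)
    then have "Sup (room F) / 2 < Sup (room F)"
      using nz by (cases "Sup (room F)") (auto simp: ennreal_divide_numeral ennreal_less_iff)
    then obtain G where G: "G \<in> sets M" "G \<subseteq> E - F" "emeasure M F + emeasure M G \<le> s" "Sup (room F) / 2 < emeasure M G"
      unfolding less_Sup_iff by (auto simp: room_def)
    have "emeasure M (F \<union> G) = emeasure M F + emeasure M G"
      using F G by (subst plus_emeasure) auto
    moreover have "F \<union> G - F = G"
      using G by auto
    moreover have "Sup (room F) \<le> 2 * emeasure M G"
      using G(4) by (subst (asm) divide_less_ennreal) (auto simp: mult.commute)
    ultimately show ?thesis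
      using F G by (intro exI[of _ "F \<union> G"]) auto
  qed
  have "\<exists>F. \<forall>n. (F n \<in> sets M \<and> F n \<subseteq> E \<and> emeasure M (F n) \<le> s) \<and>
      (F n \<subseteq> F (Suc n) \<and> Sup (room (F n)) \<le> 2 * emeasure M (F (Suc n) - F n))"
  proof (rule dependent_nat_choice)
    show "\<exists>F. F \<in> sets M \<and> F \<subseteq> E \<and> emeasure M F \<le> s"
      by (rule exI[of _ "{}"]) simp
  qed (rule step)
  then obtain F where F: "\<And>n. F n \<in> sets M" "\<And>n. F n \<subseteq> E" "\<And>n. emeasure M (F n) \<le> s"
    and inc: "\<And>n. F n \<subseteq> F (Suc n)" "\<And>n. Sup (room (F n)) \<le> 2 * emeasure M (F (Suc n) - F n)"
    by blast
  define U where "U = (\<Union>n. F n)"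
  have U: "U \<in> sets M" "U \<subseteq> E"
    using F by (auto simp: U_def)
  have "emeasure M U = (SUP n. emeasure M (F n))"
    unfolding U_def using F(1) incseq_SucI[of F, OF inc(1)] by (intro SUP_emeasure_incseq[symmetric]) auto
  then have le: "emeasure M U \<le> s"
    using F by (auto intro: SUP_least)
  have "emeasure M U = s"
  proof (rule ccontr)
    assume "emeasure M U \<noteq> s"
    then have less: "emeasure M U < s" using le by simp
    have "emeasure M U + emeasure M (E - U) = emeasure M E"
      using U E by (subst plus_emeasure) (auto simp: Un_absorb1)
    then have "0 < emeasure M (E - U)"
      using less s by (auto simp: zero_less_iff_neq_zero)
    then obtain G where G: "G \<in> sets M" "G \<subseteq> E - U" "0 < emeasure M G" "emeasure M G \<le> s - emeasure M U"
      using nonatomic_small_subset[OF M _ _ diff_gr0_ennreal[OF less]] U E by blast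
    have room: "emeasure M G \<le> Sup (room (F n))" for n
    proof (rule Sup_upper)
      have "emeasure M (F n) \<le> emeasure M U"
        using U by (intro emeasure_mono) (auto simp: U_def)
      then have "emeasure M (F n) + emeasure M G \<le> emeasure M U + (s - emeasure M U)"
        by (intro add_mono G)
      also have "\<dots> = s"
        using less le by (simp add: add_diff_inverse_ennreal)
      finally show "emeasure M G \<in> room (F n)"
        using G unfolding room_def U_def by blast
    qed
    have grow: "of_nat n * emeasure M G \<le> 2 * emeasure M (F n)" for n
    proof (induction n)
      case (Suc k)
      have "of_nat (Suc k) * emeasure M G = of_nat k * emeasure M G + emeasure M G"
        by (simp add: distrib_right add.commute)
      also have "\<dots> \<le> 2 * emeasure M (F k) + 2 * emeasure M (F (Suc k) - F k)"
        by (rule add_mono[OF Suc.IH order_trans[OF room inc(2)]])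
      also have "\<dots> = 2 * (emeasure M (F k) + emeasure M (F (Suc k) - F k))"
        by (simp add: distrib_left)
      also have "emeasure M (F k) + emeasure M (F (Suc k) - F k) = emeasure M (F (Suc k))"
        using F inc(1)[of k] by (subst plus_emeasure) (auto simp: Un_absorb1)
      finally show ?case .
    qed simp
    have "2 * s / emeasure M G < \<infinity>"
      using G False by (auto simp: less_top[symmetric] ennreal_divide_eq_top_iff ennreal_mult_eq_top_iff)
    then obtain n where "2 * s / emeasure M G < of_nat n"
      using ennreal_Ex_less_of_nat by auto
    moreover have "emeasure M G < \<infinity>"
      using G(4) False by (simp add: less_top[symmetric]) (metis diff_le_self_ennreal top_unique)
    ultimately have "2 * s < of_nat n * emeasure M G"
      using G by (subst (asm) divide_less_ennreal) auto
    also have "\<dots> \<le> 2 * s"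
      using order_trans[OF grow mult_left_mono[OF F(3)]] by simp
    finally show False by simp
  qed
  then show ?thesis using U by blast
qed

lemma nonatomic_superset_of_measure:
  assumes M: "nonatomic M" and E: "E \<in> sets M" "emeasure M E \<le> s" and s: "s \<le> emeasure M (space M)"
  shows "\<exists>F\<in>sets M. E \<subseteq> F \<and> emeasure M F = s"
proof (cases "emeasure M E = \<infinity>")
  case True
  then show ?thesis using E by (intro bexI[of _ E]) (auto simp: top_unique)
next
  case False
  have "emeasure M (space M - E) = emeasure M (space M) - emeasure M E"
    using E False by (intro emeasure_Diff) (auto dest: sets.sets_into_space)
  then have "s - emeasure M E \<le> emeasure M (space M - E)"
    using ennreal_minus_mono[OF s order_refl] by simp
  then obtain G where G: "G \<in> sets M" "G \<subseteq> space M - E" "emeasure M G = s - emeasure M E"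
    using nonatomic_subset_of_measure[OF M sets.Diff[OF sets.top E(1)]] by blast
  have "emeasure M (E \<union> G) = emeasure M E + emeasure M G"
    using G E by (intro plus_emeasure[symmetric]) auto
  also have "\<dots> = s"
    unfolding G(3) by (rule add_diff_inverse_ennreal[OF E(2)])
  finally show ?thesis
    using E G by (intro bexI[of _ "E \<union> G"]) auto
qed

section \<open>Comparison of fundamental functions from inclusion\<close>

text \<open>The two halves of the statement that \<open>Z\<close> has fundamental function \<open>1 / right_inverse A (1 / t)\<close>, each in
the form in which a gliding hump uses it. The first bounds the norm of indicators from above, with enough
completeness to sum a series of them; the second bounds it from below.\<close>

definition contains_bump_series :: "'a measure \<Rightarrow> ('a \<Rightarrow> ereal) set \<Rightarrow> (ennreal \<Rightarrow> ennreal) \<Rightarrow> bool" where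
  "contains_bump_series M Z A \<longleftrightarrow> (\<forall>E.
     (\<forall>n. E n \<in> sets M \<and> 0 < emeasure M (E n) \<and> emeasure M (E n) < \<infinity>) \<longrightarrow>
     (\<lambda>x. enn2ereal (SUP n. ennreal ((1/2) ^ Suc n) * right_inverse A (1 / emeasure M (E n)) * indicator (E n) x)) \<in> Z)"

definition controls_bumps :: "'a measure \<Rightarrow> ('a \<Rightarrow> ereal) set \<Rightarrow> (ennreal \<Rightarrow> ennreal) \<Rightarrow> bool" where
  "controls_bumps M Z B \<longleftrightarrow> (\<forall>f\<in>Z. \<exists>l<\<infinity>. \<forall>E a.
     E \<in> sets M \<longrightarrow> 0 < emeasure M E \<longrightarrow> emeasure M E < \<infinity> \<longrightarrow> a < \<infinity> \<longrightarrow> (\<forall>x\<in>E. a \<le> abs_fun f x) \<longrightarrow>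
     a \<le> l * right_inverse B (1 / emeasure M E))"

lemma not_fundamental_dominates_witness:
  assumes "\<not> fundamental_dominates M A B"
  shows "\<exists>t. \<forall>n::nat. 0 < t n \<and> t n < \<infinity> \<and> t n \<le> emeasure M (space M) \<and>
     ennreal (4 ^ Suc n) * right_inverse B (1 / t n) < right_inverse A (1 / t n)"
proof -
  have "\<exists>t. 0 < t \<and> t < \<infinity> \<and> t \<le> emeasure M (space M) \<and>
     ennreal (4 ^ Suc n) * right_inverse B (1 / t) < right_inverse A (1 / t)" for n :: nat
  proof (rule ccontr)
    assume *: "\<not> ?thesis"
    have "\<forall>t. 0 < t \<longrightarrow> t < \<infinity> \<longrightarrow> t \<le> emeasure M (space M) \<longrightarrow>
        right_inverse A (1 / t) \<le> ennreal (4 ^ Suc n) * right_inverse B (1 / t)"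
    proof (intro allI impI leI notI)
      fix t assume "0 < t" "t < \<infinity>" "t \<le> emeasure M (space M)"
        "ennreal (4 ^ Suc n) * right_inverse B (1 / t) < right_inverse A (1 / t)"
      then show False using * by blast
    qed
    moreover have "ennreal (4 ^ Suc n) < \<infinity>"
      by simp
    ultimately have "fundamental_dominates M A B"
      unfolding fundamental_dominates_def by blast
    then show False using assms by blast
  qed
  then have "\<forall>n. \<exists>t. 0 < t \<and> t < \<infinity> \<and> t \<le> emeasure M (space M) \<and>
     ennreal (4 ^ Suc n) * right_inverse B (1 / t) < right_inverse A (1 / t)" by blast
  from choice[OF this] show ?thesis .
qed

text \<open>The gliding hump: where the comparison fails by the factor \<open>4\<^sup>n\<^sup>+\<^sup>1\<close>, the weights \<open>2\<^sup>-\<^sup>n\<^sup>-\<^sup>1\<close> that make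
the bumps summable in \<open>Z\<close> still leave them unbounded in \<open>Z'\<close>.\<close>

lemma fundamental_dominates_if_subset:
  assumes M: "nonatomic M" and A: "quasi_convex A" and B: "quasi_convex B"
    and Z: "contains_bump_series M Z A" and Z': "controls_bumps M Z' B" and sub: "Z \<subseteq> Z'"
  shows "fundamental_dominates M A B"
proof (rule ccontr)
  assume "\<not> fundamental_dominates M A B"
  then obtain t where t: "\<And>n::nat. 0 < t n" "\<And>n. t n < \<infinity>" "\<And>n. t n \<le> emeasure M (space M)"
    and less: "\<And>n. ennreal (4 ^ Suc n) * right_inverse B (1 / t n) < right_inverse A (1 / t n)"
    using not_fundamental_dominates_witness by blast
  have "\<forall>n. \<exists>E. E \<in> sets M \<and> emeasure M E = t n"
    using nonatomic_subset_of_measure[OF M sets.top t(3)] by blast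
  from choice[OF this] obtain E where E: "\<And>n. E n \<in> sets M" "\<And>n. emeasure M (E n) = t n"
    by blast
  define a where "a n = ennreal ((1/2) ^ Suc n) * right_inverse A (1 / t n)" for n
  define f where "f x = (SUP n. a n * indicator (E n) x)" for x
  have "(\<lambda>x. enn2ereal (f x)) \<in> Z'"
    using Z[unfolded contains_bump_series_def, rule_format, of E] sub E t unfolding f_def a_def by auto
  then obtain l where l: "l < \<infinity>" and det: "\<And>F b. F \<in> sets M \<Longrightarrow> 0 < emeasure M F \<Longrightarrow> emeasure M F < \<infinity> \<Longrightarrow>
      b < \<infinity> \<Longrightarrow> (\<forall>x\<in>F. b \<le> f x) \<Longrightarrow> b \<le> l * right_inverse B (1 / emeasure M F)"
    using bspec[OF Z'[unfolded controls_bumps_def], of "\<lambda>x. enn2ereal (f x)"]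
    unfolding abs_fun_enn2ereal by blast
  have RA: "0 < right_inverse A (1 / t n)" "right_inverse A (1 / t n) < \<infinity>" for n
    using right_inverse_pos[OF A] right_inverse_finite[OF A] one_divide_pos_finite[OF t(1,2)] by auto
  have "ennreal (2 ^ n) \<le> l" for n
  proof -
    have "a n \<le> f x" if "x \<in> E n" for x
      unfolding f_def using that by (intro SUP_upper2[of n]) auto
    then have "a n \<le> l * right_inverse B (1 / t n)"
      using det[of "E n" "a n"] E t RA by (simp add: a_def ennreal_mult_less_top)
    then have "ennreal (4 ^ Suc n) * a n \<le> l * (ennreal (4 ^ Suc n) * right_inverse B (1 / t n))"
      by (metis mult.left_commute mult_left_mono zero_le)
    also have "\<dots> \<le> l * right_inverse A (1 / t n)"
      by (intro mult_left_mono less_imp_le[OF less]) simp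
    finally have "ennreal (4 ^ Suc n) * a n \<le> l * right_inverse A (1 / t n)" .
    moreover have "ennreal (4 ^ Suc n) * a n = ennreal (2 ^ Suc n) * right_inverse A (1 / t n)"
      unfolding a_def mult.assoc[symmetric]
      by (simp flip: ennreal_mult power_mult_distrib)
    ultimately have "right_inverse A (1 / t n) * ennreal (2 ^ Suc n) \<le> right_inverse A (1 / t n) * l"
      by (simp add: mult.commute)
    then have "ennreal (2 ^ Suc n) \<le> l"
      using RA[of n] by (subst (asm) ennreal_mult_le_mult_iff) auto
    then show ?thesis
      by (rule order_trans[rotated]) (simp add: ennreal_leI)
  qed
  then show False using powers_of_two_unbounded_ennreal l by blast
qed

text \<open>Since \<open>A (right_inverse A (1 / t)) \<le> 1 / t\<close>, star-shapedness bounds the modular of the \<open>n\<close>-th bump by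
its weight, and the weights add up to \<open>1\<close>. The bumps may overlap, because \<open>A\<close> of a supremum is at most
the sum of the values of \<open>A\<close>.\<close>

lemma orlicz_space_contains_bump_series:
  fixes M :: "'a measure"
  assumes A: "quasi_convex A"
  shows "contains_bump_series M (orlicz_space M A) A"
  unfolding contains_bump_series_def
proof (intro allI impI)
  fix E :: "nat \<Rightarrow> 'a set"
  assume E: "\<forall>n. E n \<in> sets M \<and> 0 < emeasure M (E n) \<and> emeasure M (E n) < \<infinity>"
  then have [measurable]: "\<And>n. E n \<in> sets M" by blast
  note [measurable] = quasi_convex_measurable[OF A]
  define a where "a n = ennreal ((1/2) ^ Suc n) * right_inverse A (1 / emeasure M (E n))" for n
  let ?f = "\<lambda>x. SUP n. a n * indicator (E n) x"
  have a: "A (a n) * emeasure M (E n) \<le> ennreal ((1/2) ^ Suc n)" for n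
  proof -
    let ?m = "emeasure M (E n)"
    have "A (a n) \<le> ennreal ((1/2) ^ Suc n) * A (right_inverse A (1 / ?m))"
      unfolding a_def by (rule star_shapedD[OF quasi_convex_star_shaped[OF A]]) (simp add: power_le_one del: power_Suc)
    also have "\<dots> \<le> ennreal ((1/2) ^ Suc n) * (1 / ?m)"
      using le_right_inverse_iff[OF A] by (intro mult_left_mono) auto
    finally have "A (a n) * ?m \<le> ennreal ((1/2) ^ Suc n) * (1 / ?m) * ?m"
      by (rule mult_right_mono) simp
    also have "\<dots> = ennreal ((1/2) ^ Suc n)"
      using ennreal_mult_divide_cancel[of ?m 1] E by (metis mult.assoc mult.commute mult.right_neutral)
    finally show ?thesis .
  qed
  have "(\<integral>\<^sup>+ x. A (?f x / 1) \<partial>M) \<le> (\<integral>\<^sup>+ x. (\<Sum>n. A (a n) * indicator (E n) x) \<partial>M)"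
  proof (rule nn_integral_mono)
    fix x
    have "A (?f x) \<le> (\<Sum>n. A (a n * indicator (E n) x))"
      by (rule quasi_convex_SUP_le_suminf[OF A])
    also have "(\<lambda>n. A (a n * indicator (E n) x)) = (\<lambda>n. A (a n) * indicator (E n) x)"
      using quasi_convex_zero[OF A] by (auto simp: indicator_def)
    finally show "A (?f x / 1) \<le> (\<Sum>n. A (a n) * indicator (E n) x)"
      by (simp add: divide_ennreal_def)
  qed
  also have "\<dots> = (\<Sum>n. A (a n) * emeasure M (E n))"
    by (subst nn_integral_suminf) (auto simp: nn_integral_cmult_indicator)
  also have "\<dots> \<le> (\<Sum>n. ennreal ((1/2) ^ Suc n))"
    by (intro suminf_le a) auto
  also have "\<dots> < \<infinity>"
    unfolding suminf_half_powers by simp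
  finally show "(\<lambda>x. enn2ereal (SUP n. ennreal ((1/2) ^ Suc n) * right_inverse A (1 / emeasure M (E n)) * indicator (E n) x))
      \<in> orlicz_space M A"
    by (intro orlicz_spaceI[OF A, where l = 1]) (auto simp: a_def simp del: power_Suc)
qed

text \<open>Chebyshev's inequality for the modular.\<close>

lemma orlicz_space_controls_bumps:
  assumes B: "quasi_convex B"
  shows "controls_bumps M (orlicz_space M B) B"
  unfolding controls_bumps_def
proof
  fix f assume "f \<in> orlicz_space M B"
  then obtain l where f[measurable]: "f \<in> borel_measurable M" and l: "0 < l" "l < \<infinity>"
    and int: "(\<integral>\<^sup>+ x. B (abs_fun f x / l) \<partial>M) \<le> 1"
    using orlicz_spaceD by blast
  show "\<exists>l<\<infinity>. \<forall>E a. E \<in> sets M \<longrightarrow> 0 < emeasure M E \<longrightarrow> emeasure M E < \<infinity> \<longrightarrow> a < \<infinity> \<longrightarrow>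
      (\<forall>x\<in>E. a \<le> abs_fun f x) \<longrightarrow> a \<le> l * right_inverse B (1 / emeasure M E)"
  proof (intro exI[of _ l] conjI allI impI l)
    fix E a
    assume E: "E \<in> sets M" "0 < emeasure M E" "emeasure M E < \<infinity>" and a: "\<forall>x\<in>E. a \<le> abs_fun f x"
    have "B (a / l) * emeasure M E = (\<integral>\<^sup>+ x. B (a / l) * indicator E x \<partial>M)"
      using E by (simp add: nn_integral_cmult_indicator)
    also have "\<dots> \<le> (\<integral>\<^sup>+ x. B (abs_fun f x / l) \<partial>M)"
      using a by (intro nn_integral_mono)
        (auto simp: indicator_def intro!: quasi_convex_mono[OF B] divide_right_mono_ennreal)
    finally have *: "B (a / l) * emeasure M E \<le> 1"
      using int by simp
    have "B (a / l) = B (a / l) * emeasure M E / emeasure M E"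
      using E by (simp add: mult_divide_eq_ennreal)
    also have "\<dots> \<le> 1 / emeasure M E"
      by (rule divide_right_mono_ennreal[OF *])
    finally have "a / l \<le> right_inverse B (1 / emeasure M E)"
      by (simp add: le_right_inverse_iff[OF B])
    then have "l * (a / l) \<le> l * right_inverse B (1 / emeasure M E)"
      by (rule mult_left_mono) simp
    then show "a \<le> l * right_inverse B (1 / emeasure M E)"
      using ennreal_mult_divide_cancel[OF l] by simp
  qed
qed

section \<open>Slicing a set along the levels of a function\<close>

text \<open>The slice consists of the points where \<open>f\<close> exceeds a quantile \<open>c\<close>, filled up to measure \<open>d\<close> from the
level set of \<open>c\<close>. For a simple function the quantile is the largest value, or \<open>0\<close>, that \<open>f\<close>
attains or exceeds on a set of measure at least \<open>d\<close>.\<close>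

lemma top_slice:
  fixes f :: "'a \<Rightarrow> ennreal"
  assumes M: "nonatomic M" and E[measurable]: "E \<in> sets M" and d: "d \<le> emeasure M E"
    and f: "simple_function M f" and fin: "emeasure M E < \<infinity>" and bd: "\<And>x. x \<in> E \<Longrightarrow> f x \<le> b"
  shows "\<exists>F\<in>sets M. \<exists>c\<le>b. F \<subseteq> E \<and> emeasure M F = d \<and> (\<forall>x\<in>F. c \<le> f x) \<and> (\<forall>x\<in>E - F. f x \<le> c)"
proof -
  note [measurable] = borel_measurable_simple_function[OF f]
  have E_space: "E \<subseteq> space M"
    using sets.sets_into_space[OF E] .
  have finE: "finite (f ` E)"
    using simple_functionD(1)[OF f] E_space by (meson finite_subset image_mono)
  let ?V = "{v \<in> insert 0 (f ` E). d \<le> emeasure M {x \<in> E. v \<le> f x}}"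
  have meas: "{x \<in> E. v \<le> f x} \<in> sets M" "{x \<in> E. v < f x} \<in> sets M" for v
  proof -
    have "{x \<in> E. v \<le> f x} = {x \<in> space M. v \<le> f x} \<inter> E" "{x \<in> E. v < f x} = {x \<in> space M. v < f x} \<inter> E"
      using E_space by auto
    moreover have "{x \<in> space M. v \<le> f x} \<inter> E \<in> sets M" "{x \<in> space M. v < f x} \<inter> E \<in> sets M"
      by measurable
    ultimately show "{x \<in> E. v \<le> f x} \<in> sets M" "{x \<in> E. v < f x} \<in> sets M"
      by argo+
  qed
  have V: "finite ?V" "?V \<noteq> {}"
    using finE d by auto
  define c where "c = Max ?V"
  have c: "c \<in> ?V"
    unfolding c_def by (rule Max_in[OF V])
  have "c = 0 \<or> c \<in> f ` E"
    using c by blast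
  then have "c \<le> b"
    using bd by (metis imageE zero_le)
  have upper: "emeasure M {x \<in> E. c < f x} \<le> d"
  proof (cases "{x \<in> E. c < f x} = {}")
    case True
    then show ?thesis by (simp only: emeasure_empty zero_le)
  next
    case False
    let ?W = "{v \<in> f ` E. c < v}"
    have W: "finite ?W" "?W \<noteq> {}"
      using finE False by auto
    define v where "v = Min ?W"
    have v: "v \<in> ?W"
      unfolding v_def by (rule Min_in[OF W])
    have "v \<le> f x" if "x \<in> E" "c < f x" for x
      unfolding v_def using W(1) that by (intro Min_le) simp_all
    then have "{x \<in> E. c < f x} \<subseteq> {x \<in> E. v \<le> f x}"
      by blast
    then have "emeasure M {x \<in> E. c < f x} \<le> emeasure M {x \<in> E. v \<le> f x}"
      by (intro emeasure_mono meas)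
    also have "\<dots> \<le> d"
    proof (rule ccontr)
      assume "\<not> emeasure M {x \<in> E. v \<le> f x} \<le> d"
      then have "v \<in> ?V" using v by auto
      then have "v \<le> c" unfolding c_def by (rule Max_ge[OF V(1)])
      then show False using v by auto
    qed
    finally show ?thesis .
  qed
  let ?U = "{x \<in> E. c < f x}" and ?D = "{x \<in> E. c \<le> f x}"
  have "emeasure M ?U \<le> emeasure M E"
    by (rule emeasure_mono[OF _ E]) blast
  then have "emeasure M ?U \<noteq> \<infinity>"
    using fin by (metis leD)
  then have diff: "emeasure M (?D - ?U) = emeasure M ?D - emeasure M ?U"
    using meas by (intro emeasure_Diff) auto
  have "d \<le> emeasure M ?D"
    using c unfolding mem_Collect_eq by (rule conjunct2)
  then have "d - emeasure M ?U \<le> emeasure M (?D - ?U)"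
    unfolding diff by (rule ennreal_minus_mono) (rule order_refl)
  from nonatomic_subset_of_measure[OF M sets.Diff[OF meas(1) meas(2)] this]
  obtain G where G: "G \<in> sets M" "G \<subseteq> ?D - ?U" "emeasure M G = d - emeasure M ?U"
    by (elim bexE conjE)
  have "emeasure M (?U \<union> G) = emeasure M ?U + emeasure M G"
    using G(1,2) by (intro plus_emeasure[symmetric] meas) auto
  also have "\<dots> = d"
    unfolding G(3) by (rule add_diff_inverse_ennreal[OF upper])
  finally have "emeasure M (?U \<union> G) = d" .
  moreover have "?U \<union> G \<in> sets M" "?U \<union> G \<subseteq> E"
    using G meas(2)[of c] by auto
  moreover have "\<forall>x\<in>?U \<union> G. c \<le> f x" "\<forall>x\<in>E - (?U \<union> G). f x \<le> c"
    using G(2) by (auto simp: not_less)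
  ultimately show ?thesis
    using \<open>c \<le> b\<close> by blast
qed

text \<open>Cutting off top slices one after another, each slice bounds \<open>f\<close> on the next one from above. Hence the
lower step function \<open>\<Sum> a i \<chi>(P i)\<close> loses at most the integral over the first slice, which is bounded by \<open>b d\<close>.\<close>

lemma sorted_slices:
  fixes f :: "'a \<Rightarrow> ennreal"
  assumes M: "nonatomic M" and f: "simple_function M f" and d: "d < \<infinity>"
    and E: "E \<in> sets M" "emeasure M E = of_nat q * d" and bd: "\<And>x. x \<in> E \<Longrightarrow> f x \<le> b"
  shows "\<exists>P a. (\<forall>i<q. P i \<in> sets M \<and> P i \<subseteq> E \<and> emeasure M (P i) = d \<and> a i \<le> b \<and> (\<forall>x\<in>P i. a i \<le> f x)) \<and>
    disjoint_family_on P {..<q} \<and> (\<integral>\<^sup>+x\<in>E. f x \<partial>M) \<le> b * d + (\<Sum>i<q. a i) * d"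
  using E bd
proof (induction q arbitrary: E b)
  case 0
  have "(\<integral>\<^sup>+x\<in>E. f x \<partial>M) = 0"
    using 0 by (intro nn_integral_null_set) (auto simp: null_sets_def)
  then show ?case by (auto simp: disjoint_family_on_def)
next
  case (Suc q)
  note [measurable] = borel_measurable_simple_function[OF f] Suc.prems(1)
  have fin: "emeasure M E < \<infinity>"
    using Suc.prems d by (simp add: ennreal_mult_less_top of_nat_less_top ennreal_add_less_top distrib_right)
  have "d \<le> emeasure M E"
    using Suc.prems by (simp add: distrib_right)
  from top_slice[OF M Suc.prems(1) this f fin Suc.prems(3)]
  obtain F c where F: "F \<in> sets M" "F \<subseteq> E" "emeasure M F = d" "c \<le> b"
    and c: "\<forall>x\<in>F. c \<le> f x" "\<forall>x\<in>E - F. f x \<le> c"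
    by blast
  note [measurable] = F(1)
  have "emeasure M (E - F) = emeasure M E - d"
    using F fin Suc.prems by (subst emeasure_Diff) (auto simp: less_top d[simplified])
  also have "\<dots> = of_nat q * d"
    using Suc.prems d by (simp add: distrib_right)
  finally have "emeasure M (E - F) = of_nat q * d" .
  then obtain P a where P: "\<And>i. i < q \<Longrightarrow> P i \<in> sets M \<and> P i \<subseteq> E - F \<and> emeasure M (P i) = d \<and> a i \<le> c \<and> (\<forall>x\<in>P i. a i \<le> f x)"
    and disj: "disjoint_family_on P {..<q}"
    and int: "(\<integral>\<^sup>+x\<in>E - F. f x \<partial>M) \<le> c * d + (\<Sum>i<q. a i) * d"
    using Suc.IH[of "E - F" c] c by auto
  define P' where "P' i = (if i = q then F else P i)" for i
  define a' where "a' i = (if i = q then c else a i)" for i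
  have "(\<integral>\<^sup>+x\<in>E. f x \<partial>M) = (\<integral>\<^sup>+x. f x * indicator F x + f x * indicator (E - F) x \<partial>M)"
    using F by (intro nn_integral_cong) (auto simp: indicator_def)
  also have "\<dots> = (\<integral>\<^sup>+x\<in>F. f x \<partial>M) + (\<integral>\<^sup>+x\<in>E - F. f x \<partial>M)"
    by (rule nn_integral_add) measurable
  also have "(\<integral>\<^sup>+x\<in>F. f x \<partial>M) \<le> (\<integral>\<^sup>+x. b * indicator F x \<partial>M)"
    using F Suc.prems(3) by (intro nn_integral_mono) (auto simp: indicator_def)
  also have "\<dots> = b * d"
    using F by (simp add: nn_integral_cmult_indicator)
  also have "b * d + (\<integral>\<^sup>+x\<in>E - F. f x \<partial>M) \<le> b * d + (c * d + (\<Sum>i<q. a i) * d)"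
    by (intro add_left_mono int)
  also have "c * d + (\<Sum>i<q. a i) * d = (\<Sum>i<Suc q. a' i) * d"
    by (simp add: a'_def distrib_right add.commute)
  finally have "(\<integral>\<^sup>+x\<in>E. f x \<partial>M) \<le> b * d + (\<Sum>i<Suc q. a' i) * d" by simp
  moreover have "disjoint_family_on P' {..<Suc q}"
    unfolding disjoint_family_on_def
  proof (intro ballI impI)
    have old: "P m \<inter> P n = {}" if "m < q" "n < q" "m \<noteq> n" for m n
      using disj that by (auto simp: disjoint_family_on_def)
    have new: "P m \<inter> F = {}" if "m < q" for m
      using P[OF that] by blast
    fix m n assume "m \<in> {..<Suc q}" "n \<in> {..<Suc q}" "m \<noteq> n"
    then consider "m < q" "n < q" | "m = q" "n < q" | "m < q" "n = q"
      by (auto simp: less_Suc_eq)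
    then show "P' m \<inter> P' n = {}"
      using old[of m n] new \<open>m \<noteq> n\<close> by cases (auto simp: P'_def)
  qed
  moreover have "\<forall>i<Suc q. P' i \<in> sets M \<and> P' i \<subseteq> E \<and> emeasure M (P' i) = d \<and> a' i \<le> b \<and> (\<forall>x\<in>P' i. a' i \<le> f x)"
  proof (intro allI impI)
    fix i assume "i < Suc q"
    then consider "i = q" | "i < q" by linarith
    then show "P' i \<in> sets M \<and> P' i \<subseteq> E \<and> emeasure M (P' i) = d \<and> a' i \<le> b \<and> (\<forall>x\<in>P' i. a' i \<le> f x)"
    proof cases
      case 1
      then show ?thesis using F c by (simp add: P'_def a'_def)
    next
      case 2
      then show ?thesis using P[OF 2] order_trans[OF _ F(4)] by (auto simp: P'_def a'_def)
    qed
  qed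
  ultimately show ?case by blast
qed

lemma bij_betw_add_mod:
  fixes q k :: nat
  assumes "0 < q"
  shows "bij_betw (\<lambda>i. (i + k) mod q) {..<q} {..<q}"
proof -
  have inj: "inj_on (\<lambda>i. (i + k) mod q) {..<q}"
  proof (rule inj_onI)
    fix i j assume ij: "i \<in> {..<q}" "j \<in> {..<q}" "(i + k) mod q = (j + k) mod q"
    have *: "i = j" if "j \<le> i" "i < q" "(i + k) mod q = (j + k) mod q" for i j
    proof -
      have "q dvd (i + k) - (j + k)"
        using that(1,3) mod_eq_dvd_iff_nat[of "j + k" "i + k" q] by simp
      then have "q dvd i - j" by simp
      moreover have "\<not> q \<le> i - j"
        using that(2) by simp
      ultimately have "i - j = 0"
        using dvd_imp_le[of q "i - j"] by blast
      then show ?thesis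
        using that(1) by simp
    qed
    show "i = j"
    proof (cases "j \<le> i")
      case True
      then show ?thesis using ij *[OF True] by simp
    next
      case False
      then have "i \<le> j" by simp
      from *[OF this] show ?thesis using ij by simp
    qed
  qed
  have "(\<lambda>i. (i + k) mod q) ` {..<q} \<subseteq> {..<q}"
    using assms by auto
  then show ?thesis
    using inj endo_inj_surj[OF finite_lessThan _ inj] by (simp add: bij_betw_def)
qed

section \<open>Binary digits of a number in the unit interval\<close>

text \<open>What is left of \<open>y\<close> after subtracting its first \<open>k\<close> binary digits. The digits are chosen greedily, so
\<open>1\<close> has the expansion \<open>0.111...\<close>.\<close>

primrec binary_remainder :: "nat \<Rightarrow> real \<Rightarrow> real" where
  "binary_remainder 0 y = y"
| "binary_remainder (Suc k) y =
     (if (1/2) ^ Suc k \<le> binary_remainder k y then binary_remainder k y - (1/2) ^ Suc k else binary_remainder k y)"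

lemma binary_remainder_bounds:
  assumes "0 \<le> y" "y \<le> 1"
  shows "0 \<le> binary_remainder k y \<and> binary_remainder k y \<le> (1/2) ^ k"
  using assms by (induction k) auto

lemma binary_remainder_measurable [measurable]: "binary_remainder k \<in> borel_measurable borel"
proof (induction k)
  case (Suc k)
  note [measurable] = Suc.IH
  show ?case
    unfolding binary_remainder.simps by measurable
qed simp

lemma binary_expansion_sums:
  assumes y: "0 \<le> y" "y \<le> 1"
  shows "(\<lambda>k. (1/2) ^ Suc k * of_bool ((1/2) ^ Suc k \<le> binary_remainder k y)) sums y"
proof -
  have "(\<Sum>k<n. (1/2) ^ Suc k * of_bool ((1/2) ^ Suc k \<le> binary_remainder k y)) = y - binary_remainder n y" for n
    by (induction n) auto
  moreover have "(\<lambda>n. binary_remainder n y) \<longlonglongrightarrow> 0"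
  proof (rule tendsto_sandwich[where f = "\<lambda>_. 0" and h = "\<lambda>n. (1/2) ^ n"])
    show "(\<lambda>n. (1/2::real) ^ n) \<longlonglongrightarrow> 0"
      by (rule LIMSEQ_realpow_zero) auto
  qed (use binary_remainder_bounds[OF y] in auto)
  then have "(\<lambda>n. y - binary_remainder n y) \<longlonglongrightarrow> y - 0"
    by (intro tendsto_intros)
  ultimately show ?thesis
    by (simp add: sums_def)
qed

section \<open>Rearrangement-invariant norms and their fundamental functions\<close>

locale nonatomic_ri_norm = ri_norm M \<rho> + sigma_finite_measure M
  for M :: "'a measure" and \<rho> +
  assumes nonatomic: "nonatomic M"
begin

abbreviation \<phi> :: "ennreal \<Rightarrow> ennreal" where "\<phi> \<equiv> fundamental_function M \<rho>"

lemma norm_mono: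
  "f \<in> borel_measurable M \<Longrightarrow> g \<in> borel_measurable M \<Longrightarrow> (\<And>x. x \<in> space M \<Longrightarrow> f x \<le> g x) \<Longrightarrow> \<rho> f \<le> \<rho> g"
  by (rule monotone) auto

lemma norm_zero: "\<rho> (\<lambda>_. 0) = 0"
  using homogeneous[of "\<lambda>_. 0" 0] by simp

lemma norm_cmult:
  assumes "f \<in> borel_measurable M" "c < \<infinity>"
  shows "\<rho> (\<lambda>x. c * f x) = c * \<rho> f"
  using homogeneous[OF assms(1), of "enn2real c"] assms(2) by (simp add: ennreal_enn2real_if less_top[symmetric])

lemma norm_sum_le:
  assumes "finite I" "\<And>i. i \<in> I \<Longrightarrow> F i \<in> borel_measurable M"
  shows "\<rho> (\<lambda>x. \<Sum>i\<in>I. F i x) \<le> (\<Sum>i\<in>I. \<rho> (F i))"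
  using assms
proof (induction I rule: finite_induct)
  case empty
  then show ?case by (simp add: norm_zero)
next
  case (insert i I)
  then have "\<rho> (\<lambda>x. F i x + (\<Sum>i\<in>I. F i x)) \<le> \<rho> (F i) + \<rho> (\<lambda>x. \<Sum>i\<in>I. F i x)"
    by (intro triangle) auto
  also have "\<dots> \<le> \<rho> (F i) + (\<Sum>i\<in>I. \<rho> (F i))"
    using insert by (intro add_left_mono) auto
  finally show ?case using insert by simp
qed

text \<open>The triangle inequality passes to series by the Fatou property.\<close>

lemma norm_suminf_le:
  assumes F[measurable]: "\<And>n::nat. F n \<in> borel_measurable M"
  shows "\<rho> (\<lambda>x. \<Sum>n. F n x) \<le> (\<Sum>n. \<rho> (F n))"
proof -
  have "(\<lambda>N. \<rho> (\<lambda>x. \<Sum>n<N. F n x)) \<longlonglongrightarrow> \<rho> (\<lambda>x. \<Sum>n. F n x)"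
  proof (rule conjunct2[OF Fatou])
    show "AE x in M. incseq (\<lambda>N. \<Sum>n<N. F n x) \<and> (\<lambda>N. \<Sum>n<N. F n x) \<longlonglongrightarrow> (\<Sum>n. F n x)"
      by (intro AE_I2 conjI summable_LIMSEQ) (auto intro!: incseq_SucI)
  qed measurable
  moreover have "\<rho> (\<lambda>x. \<Sum>n<N. F n x) \<le> (\<Sum>n. \<rho> (F n))" for N
    using norm_sum_le[of "{..<N}" F] sum_le_suminf[of "\<lambda>n. \<rho> (F n)" "{..<N}"]
    by (auto intro: order_trans)
  ultimately show ?thesis
    by (intro LIMSEQ_le_const2) auto
qed

text \<open>Equal distribution functions have equal rearrangements.\<close>

lemma norm_equimeasurable:
  assumes "f \<in> borel_measurable M" "g \<in> borel_measurable M"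
    and "\<And>l. emeasure M {x \<in> space M. l < f x} = emeasure M {x \<in> space M. l < g x}"
  shows "\<rho> f = \<rho> g"
  using assms by (intro rearrangement_invariant) (auto simp: rearrangement_def[abs_def] distribution_fun_def)

text \<open>On a null measure space every function vanishes almost everywhere.\<close>

lemma ri_space_null:
  assumes m: "emeasure M (space M) = 0"
  shows "ri_space M \<rho> = borel_measurable M"
proof -
  have "\<rho> (abs_fun f) < \<infinity>" if "f \<in> borel_measurable M" for f
  proof -
    have "AE x in M. False"
      by (rule AE_I[of _ _ "space M"]) (auto simp: m)
    then have "AE x in M. abs_fun f x \<le> 0"
      by eventually_elim simp
    then have "\<rho> (abs_fun f) \<le> \<rho> (\<lambda>_. 0)"
      using that by (intro monotone) auto
    then show ?thesis
      by (simp add: norm_zero)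
  qed
  then show ?thesis
    by (auto simp: ri_space_def)
qed

lemma norm_indicator:
  assumes E: "E \<in> sets M"
  shows "\<rho> (indicator E) = \<phi> (emeasure M E)"
proof -
  have min: "min (emeasure M E) (emeasure M (space M)) = emeasure M E"
    by (rule min.absorb1) (rule emeasure_space)
  let ?P = "\<lambda>F. F \<in> sets M \<and> emeasure M F = emeasure M E"
  have F: "?P (SOME F. ?P F)"
    using E by (intro someI[of ?P]) auto
  have lev: "{x \<in> space M. l < indicator G x} = (if l < 1 then G else {})" if "G \<in> sets M" for G and l :: ennreal
    using sets.sets_into_space[OF that] by (auto simp: indicator_def split: if_splits)
  show ?thesis
    unfolding fundamental_function_def min
    using E F by (intro norm_equimeasurable) (auto simp: lev)
qed

lemma fundamental_min: "\<phi> (min t (emeasure M (space M))) = \<phi> t"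
  by (simp add: fundamental_function_def)

lemma exists_set_of_truncated_measure: "\<exists>E\<in>sets M. emeasure M E = min t (emeasure M (space M))"
  using nonatomic_subset_of_measure[OF nonatomic sets.top] by (meson min.cobounded2)

lemma fundamental_mono: "s \<le> t \<Longrightarrow> \<phi> s \<le> \<phi> t"
proof -
  assume st: "s \<le> t"
  obtain E where E: "E \<in> sets M" "emeasure M E = min t (emeasure M (space M))"
    using exists_set_of_truncated_measure by blast
  have "min s (emeasure M (space M)) \<le> emeasure M E"
    using st E by (simp add: min.coboundedI1 min_le_iff_disj)
  then obtain F where F: "F \<in> sets M" "F \<subseteq> E" "emeasure M F = min s (emeasure M (space M))"
    using nonatomic_subset_of_measure[OF nonatomic E(1)] by blast
  have "\<rho> (indicator F) \<le> \<rho> (indicator E)"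
    using E F by (intro norm_mono) (auto simp: indicator_def)
  then show ?thesis
    using E F by (simp add: norm_indicator fundamental_min)
qed

lemma fundamental_zero: "\<phi> 0 = 0"
  using norm_indicator[of "{}"] norm_zero by (simp add: indicator_def[abs_def])

text \<open>A set with \<open>\<rho> (indicator E) = 0\<close> would be a null set by definiteness.\<close>

lemma fundamental_pos:
  assumes "0 < emeasure M (space M)" "0 < t"
  shows "0 < \<phi> t"
proof (rule ccontr)
  assume "\<not> 0 < \<phi> t"
  then have z: "\<phi> t = 0" by (simp add: zero_less_iff_neq_zero)
  obtain E where E: "E \<in> sets M" "emeasure M E = min t (emeasure M (space M))"
    using exists_set_of_truncated_measure by blast
  have "\<rho> (indicator E) = 0"
    using E z by (simp add: norm_indicator fundamental_min)
  then have "AE x in M. indicator E x = (0::ennreal)"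
    using E by (intro definite) auto
  then have "AE x in M. x \<notin> E"
    by eventually_elim (auto simp: indicator_def split: if_splits)
  then have "emeasure M E = 0"
    using AE_iff_null_sets[OF E(1)] by (auto simp: null_sets_def)
  then show False
    using E assms by (auto simp: min_def split: if_splits)
qed

lemma fundamental_finite:
  assumes "t < \<infinity>"
  shows "\<phi> t < \<infinity>"
proof -
  obtain E where E: "E \<in> sets M" "emeasure M E = min t (emeasure M (space M))"
    using exists_set_of_truncated_measure by blast
  then have "\<rho> (indicator E) < \<infinity>"
    using assms by (intro indicator_finite) (auto simp: min_less_iff_disj)
  then show ?thesis
    using E by (simp add: norm_indicator fundamental_min)
qed

text \<open>In a space of infinite measure, left-continuity of \<open>\<phi>\<close> at \<open>\<infinity>\<close> is the Fatou property along a
\<open>\<sigma>\<close>-finite exhaustion.\<close>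

lemma fundamental_top_le:
  assumes le: "\<And>u. u < \<infinity> \<Longrightarrow> \<phi> u \<le> c"
  shows "\<phi> \<infinity> \<le> c"
proof (cases "emeasure M (space M) = \<infinity>")
  case True
  obtain A :: "nat \<Rightarrow> 'a set" where A: "range A \<subseteq> sets M" "(\<Union>i. A i) = space M" "\<And>i. emeasure M (A i) \<noteq> \<infinity>" "incseq A"
    using sigma_finite_incseq by blast
  have "(\<lambda>n. \<rho> (indicator (A n))) \<longlonglongrightarrow> \<rho> (indicator (space M))"
  proof (rule conjunct2[OF Fatou])
    show "AE x in M. incseq (\<lambda>n. indicator (A n) x :: ennreal) \<and> (\<lambda>n. indicator (A n) x :: ennreal) \<longlonglongrightarrow> indicator (space M) x"
    proof (intro AE_I2 conjI)
      fix x
      show "incseq (\<lambda>n. indicator (A n) x :: ennreal)"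
        using A(4) by (auto simp: incseq_def indicator_def)
      show "(\<lambda>n. indicator (A n) x :: ennreal) \<longlonglongrightarrow> indicator (space M) x"
        using LIMSEQ_indicator_incseq[OF A(4), of x] A(2) by simp
    qed
  qed (use A in auto)
  moreover have "\<rho> (indicator (A n)) \<le> c" for n
    using A le by (subst norm_indicator) (auto simp: less_top)
  ultimately have "\<rho> (indicator (space M)) \<le> c"
    by (intro LIMSEQ_le_const2) auto
  then show ?thesis
    using True by (simp add: norm_indicator)
next
  case False
  then show ?thesis
    using le[of "emeasure M (space M)"] fundamental_min[of \<infinity>] by (simp add: less_top min_def top_unique)
qed

text \<open>Averaging over cyclic shifts: the \<open>q\<close> functions that arise from the step function by rotating its values
are equimeasurable, and their sum is constant on the union of the pieces.\<close>

lemma norm_step_function: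
  assumes P[measurable]: "\<And>i. i < q \<Longrightarrow> P i \<in> sets M" and disj: "disjoint_family_on P {..<q}"
    and m: "\<And>i. i < q \<Longrightarrow> emeasure M (P i) = d" and a: "\<And>i. i < q \<Longrightarrow> a i < \<infinity>" and q: "0 < q"
  shows "(\<Sum>i<q. a i) * \<phi> (of_nat q * d) \<le> of_nat q * \<rho> (\<lambda>x. \<Sum>i<q. a i * indicator (P i) x)"
proof -
  (* f k carries the value with index i + k (mod q) on the piece with index i. *)
  define f where "f k x = (\<Sum>i<q. a ((i + k) mod q) * indicator (P i) x)" for k x
  have f[measurable]: "f k \<in> borel_measurable M" for k
    unfolding f_def[abs_def] by measurable
  have on_piece: "f k x = a ((i + k) mod q)" if "i < q" "x \<in> P i" for k i x
  proof -
    have "f k x = (\<Sum>j<q. if j = i then a ((i + k) mod q) else 0)"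
      unfolding f_def using disj that
      by (intro sum.cong) (auto simp: indicator_def disjoint_family_on_def)
    then show ?thesis using that by simp
  qed
  have off: "f k x = 0" if "\<And>i. i < q \<Longrightarrow> x \<notin> P i" for k x
    unfolding f_def using that by (intro sum.neutral) auto
  have dist: "emeasure M {x \<in> space M. l < f k x} = of_nat (card {i \<in> {..<q}. l < a i}) * d" for k l
  proof -
    let ?I = "{i \<in> {..<q}. l < a ((i + k) mod q)}"
    have "{x \<in> space M. l < f k x} = (\<Union>i\<in>?I. P i)"
    proof (intro equalityI subsetI)
      fix x assume x: "x \<in> {x \<in> space M. l < f k x}"
      then obtain i where "i < q" "x \<in> P i"
        using off[of x k] by fastforce
      then show "x \<in> (\<Union>i\<in>?I. P i)"
        using x on_piece by auto
    next
      fix x assume "x \<in> (\<Union>i\<in>?I. P i)"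
      then obtain i where "i < q" "x \<in> P i" "l < a ((i + k) mod q)" by auto
      then show "x \<in> {x \<in> space M. l < f k x}"
        using on_piece subsetD[OF sets.sets_into_space[OF P]] by auto
    qed
    also have "emeasure M \<dots> = (\<Sum>i\<in>?I. emeasure M (P i))"
      using disj by (intro sum_emeasure[symmetric]) (auto simp: disjoint_family_on_def)
    also have "\<dots> = of_nat (card ?I) * d"
      using m by simp
    also have "card ?I = card {i \<in> {..<q}. l < a i}"
    proof -
      have "bij_betw (\<lambda>i. (i + k) mod q) ?I {i \<in> {..<q}. l < a i}"
        by (rule bij_betw_Collect[OF bij_betw_add_mod[OF q]]) simp
      then show ?thesis by (rule bij_betw_same_card)
    qed
    finally show ?thesis .
  qed
  have eq: "\<rho> (f k) = \<rho> (f 0)" for k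
    by (rule norm_equimeasurable) (auto simp: dist)
  let ?U = "\<Union>i<q. P i"
  have "emeasure M ?U = (\<Sum>i<q. emeasure M (P i))"
    using disj by (intro sum_emeasure[symmetric]) auto
  then have U: "?U \<in> sets M" "emeasure M ?U = of_nat q * d"
    using m by auto
  have sum: "(\<Sum>k<q. f k x) = (\<Sum>i<q. a i) * indicator ?U x" for x
  proof (cases "x \<in> ?U")
    case True
    then obtain i where i: "i < q" "x \<in> P i" by auto
    have "(\<Sum>k<q. f k x) = (\<Sum>k<q. a ((k + i) mod q))"
      using on_piece[OF i] by (simp add: add.commute)
    also have "\<dots> = (\<Sum>i<q. a i)"
      by (rule sum.reindex_bij_betw[OF bij_betw_add_mod[OF q]])
    finally show ?thesis using True by simp
  next
    case False
    then show ?thesis using off by auto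
  qed
  have "(\<Sum>i<q. a i) * \<phi> (of_nat q * d) = \<rho> (\<lambda>x. \<Sum>k<q. f k x)"
    unfolding sum using a U by (subst norm_cmult) (auto simp: norm_indicator)
  also have "\<dots> \<le> (\<Sum>k<q. \<rho> (f k))"
    by (rule norm_sum_le) auto
  also have "\<dots> = of_nat q * \<rho> (f 0)"
    by (subst eq) simp
  also have "f 0 = (\<lambda>x. \<Sum>i<q. a i * indicator (P i) x)"
    by (auto simp: f_def fun_eq_iff intro!: sum.cong)
  finally show ?thesis .
qed

text \<open>Slicing \<open>E\<close> into \<open>q\<close> pieces and averaging the lower step function gives the inequality up to an error
\<open>b t \<phi>(t) / q\<close>, where \<open>b\<close> bounds the function.\<close>

lemma simple_integral_times_fundamental_le:
  assumes g: "simple_function M g" and fin: "\<And>x. g x < \<infinity>" and E: "E \<in> sets M" "emeasure M E < \<infinity>"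
  shows "(\<integral>\<^sup>+x\<in>E. g x \<partial>M) * \<phi> (emeasure M E) \<le> emeasure M E * \<rho> g"
proof -
  note [measurable] = borel_measurable_simple_function[OF g]
  define t where "t = emeasure M E"
  define b where "b = Max (insert 0 (g ` space M))"
  have fs: "finite (insert 0 (g ` space M))"
    using simple_functionD(1)[OF g] by simp
  have b: "b < \<infinity>"
    using Max_in[OF fs] fin unfolding b_def[symmetric] by auto
  have bd: "g x \<le> b" if "x \<in> E" for x
    unfolding b_def using that sets.sets_into_space[OF E(1)] fs by (intro Max_ge) auto
  show ?thesis
    unfolding t_def[symmetric]
  proof (rule ennreal_le_if_le_add_divide)
    show "b * t * \<phi> t < \<infinity>"
      using b E fundamental_finite[of t] by (simp add: t_def ennreal_mult_less_top)
    fix q :: nat assume q: "0 < q"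
    have q': "0 < (of_nat q :: ennreal)" "(of_nat q :: ennreal) < \<infinity>"
      using q by (auto simp: of_nat_less_top)
    define d where "d = t / of_nat q"
    have d: "of_nat q * d = t"
      unfolding d_def by (rule ennreal_mult_divide_cancel[OF q'])
    have "d \<le> t"
      unfolding d_def using q by (intro divide_le_posI_ennreal)
        (auto simp: Suc_le_eq intro!: mult_right_mono[of 1 "of_nat q" t, simplified])
    then have "d < \<infinity>"
      using E by (auto simp: t_def intro: le_less_trans)
    from sorted_slices[OF nonatomic g this E(1) _ bd, of q]
    obtain P a where P: "\<And>i. i < q \<Longrightarrow> P i \<in> sets M \<and> P i \<subseteq> E \<and> emeasure M (P i) = d \<and> a i \<le> b \<and> (\<forall>x\<in>P i. a i \<le> g x)"
      and disj: "disjoint_family_on P {..<q}"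
      and int: "(\<integral>\<^sup>+x\<in>E. g x \<partial>M) \<le> b * d + (\<Sum>i<q. a i) * d"
      using d by (auto simp: t_def)
    have Pm[measurable]: "\<And>i. i < q \<Longrightarrow> P i \<in> sets M"
      using P by blast
    have "(\<Sum>i<q. a i * indicator (P i) x) \<le> g x" for x
    proof (cases "\<exists>i<q. x \<in> P i")
      case True
      then obtain i where i: "i < q" "x \<in> P i" by blast
      have "(\<Sum>j<q. a j * indicator (P j) x) = (\<Sum>j<q. if j = i then a i else 0)"
        using disj i by (intro sum.cong) (auto simp: indicator_def disjoint_family_on_def)
      then show ?thesis using P i by auto
    next
      case False
      then have "(\<Sum>i<q. a i * indicator (P i) x) = 0"
        by (intro sum.neutral) auto
      then show ?thesis by simp
    qed
    then have le: "\<rho> (\<lambda>x. \<Sum>i<q. a i * indicator (P i) x) \<le> \<rho> g"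
      by (intro norm_mono borel_measurable_sum borel_measurable_times_ennreal
          borel_measurable_indicator borel_measurable_const Pm borel_measurable_simple_function[OF g]) auto
    have "a i < \<infinity>" if "i < q" for i
      using P[OF that] b by (auto intro: le_less_trans)
    then have "(\<Sum>i<q. a i) * \<phi> t \<le> of_nat q * \<rho> g"
      using norm_step_function[OF Pm disj, of d a] P q d mult_left_mono[OF le, of "of_nat q"]
      by (auto intro: order_trans)
    then have "(\<Sum>i<q. a i) * \<phi> t * d \<le> of_nat q * \<rho> g * d"
      by (rule mult_right_mono) simp
    also have "\<dots> = t * \<rho> g"
      by (simp add: d[symmetric] mult_ac)
    finally have main: "(\<Sum>i<q. a i) * \<phi> t * d \<le> t * \<rho> g" .
    have "(\<integral>\<^sup>+x\<in>E. g x \<partial>M) * \<phi> t \<le> (b * d + (\<Sum>i<q. a i) * d) * \<phi> t"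
      by (rule mult_right_mono[OF int]) simp
    also have "\<dots> = (\<Sum>i<q. a i) * \<phi> t * d + b * t * \<phi> t / of_nat q"
      by (simp add: d_def distrib_left distrib_right mult_ac add.commute divide_ennreal_def)
    also have "\<dots> \<le> t * \<rho> g + b * t * \<phi> t / of_nat q"
      by (rule add_right_mono[OF main])
    finally show "(\<integral>\<^sup>+x\<in>E. g x \<partial>M) * \<phi> t \<le> t * \<rho> g + b * t * \<phi> t / of_nat q" .
  qed
qed

text \<open>Hoelder's inequality on \<open>E\<close>, in which \<open>t / \<phi>(t)\<close> is the fundamental function of the associate space.\<close>

lemma integral_times_fundamental_le:
  assumes f: "f \<in> borel_measurable M" and E: "E \<in> sets M" "emeasure M E < \<infinity>"
  shows "(\<integral>\<^sup>+x\<in>E. f x \<partial>M) * \<phi> (emeasure M E) \<le> emeasure M E * \<rho> f"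
proof -
  let ?G = "{g. simple_function M g \<and> g \<le> (\<lambda>x. f x * indicator E x) \<and> (\<forall>x. g x < top)}"
  have "(\<integral>\<^sup>+x\<in>E. f x \<partial>M) * \<phi> (emeasure M E) = (SUP g\<in>?G. integral\<^sup>S M g * \<phi> (emeasure M E))"
    by (subst nn_integral_def_finite) (simp add: SUP_mult_right_ennreal)
  also have "\<dots> \<le> emeasure M E * \<rho> f"
  proof (rule SUP_least)
    fix g assume "g \<in> ?G"
    then have g: "simple_function M g" "\<And>x. g x \<le> f x * indicator E x" "\<And>x. g x < \<infinity>"
      by (auto simp: le_fun_def)
    note [measurable] = borel_measurable_simple_function[OF g(1)] f
    have "integral\<^sup>S M g = (\<integral>\<^sup>+x. g x \<partial>M)"
      by (rule nn_integral_eq_simple_integral[OF g(1), symmetric])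
    also have "\<dots> \<le> (\<integral>\<^sup>+x\<in>E. g x \<partial>M)"
    proof (rule nn_integral_mono)
      show "g x \<le> g x * indicator E x" for x
        using g(2)[of x] by (cases "x \<in> E") auto
    qed
    finally have "integral\<^sup>S M g * \<phi> (emeasure M E) \<le> (\<integral>\<^sup>+x\<in>E. g x \<partial>M) * \<phi> (emeasure M E)"
      by (rule mult_right_mono) simp
    also have "\<dots> \<le> emeasure M E * \<rho> g"
      by (rule simple_integral_times_fundamental_le[OF g(1,3) E])
    also have "\<dots> \<le> emeasure M E * \<rho> f"
    proof (intro mult_left_mono norm_mono)
      show "g x \<le> f x" for x
        using g(2)[of x] by (cases "x \<in> E") auto
    qed auto
    finally show "integral\<^sup>S M g * \<phi> (emeasure M E) \<le> emeasure M E * \<rho> f" .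
  qed
  finally show ?thesis .
qed

text \<open>Hoelder's inequality for the indicator of a subset.\<close>

lemma fundamental_quasi_concave:
  assumes m: "0 < emeasure M (space M)" and st: "s \<le> t"
  shows "s * \<phi> t \<le> t * \<phi> s"
proof -
  define m where "m = emeasure M (space M)"
  (* phi is constant beyond m, so the argument with subsets is needed for s \<le> m only. *)
  consider "s = 0" | "0 < s" "min t m = \<infinity>" | "0 < s" "min t m < \<infinity>" "s \<le> m" | "m \<le> s"
    by (cases "s = 0"; cases "s \<le> m"; cases "min t m = \<infinity>")
      (auto simp: zero_less_iff_neq_zero less_top[symmetric])
  then show ?thesis
  proof cases
    case 2
    then have "t = \<infinity>" "m = \<infinity>"
      by (auto simp: min_def top_unique split: if_splits)
    then show ?thesis
      using fundamental_pos[OF assms(1) 2(1)] by (simp add: ennreal_top_mult)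
  next
    case 3
    obtain E where E: "E \<in> sets M" "emeasure M E = min t m"
      using exists_set_of_truncated_measure unfolding m_def by blast
    have "s \<le> emeasure M E" using 3 st E by simp
    then obtain F where F: "F \<in> sets M" "F \<subseteq> E" "emeasure M F = s"
      using nonatomic_subset_of_measure[OF nonatomic E(1)] by blast
    have "(\<integral>\<^sup>+x\<in>E. indicator F x \<partial>M) = (\<integral>\<^sup>+x. indicator F x \<partial>M)"
      using F by (intro nn_integral_cong) (auto simp: indicator_def)
    also have "\<dots> = s"
      using F by simp
    finally have "s * \<phi> (min t m) \<le> min t m * \<rho> (indicator F)"
      using integral_times_fundamental_le[of "indicator F" E] E F 3 by simp
    also have "\<dots> \<le> t * \<phi> s"
      using F by (simp add: norm_indicator mult_right_mono)
    finally show ?thesis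
      by (simp add: m_def fundamental_min)
  next
    case 4
    have "\<phi> s = \<phi> t"
      using 4 st fundamental_min[of s] fundamental_min[of t] unfolding m_def[symmetric]
      by (metis min.absorb2 order_trans)
    then show ?thesis
      using st by (simp add: mult_right_mono)
  qed simp
qed

lemma fundamental_le_affine:
  assumes m: "0 < emeasure M (space M)" and T: "0 < T" "T < \<infinity>"
  shows "\<phi> u \<le> \<phi> T * (1 + u / T)"
proof (cases "u \<le> T")
  case True
  have "\<phi> u \<le> \<phi> T * 1"
    using fundamental_mono[OF True] by simp
  also have "\<dots> \<le> \<phi> T * (1 + u / T)"
    by (rule mult_left_mono) auto
  finally show ?thesis .
next
  case False
  then have "T * \<phi> u \<le> u * \<phi> T"
    by (intro fundamental_quasi_concave m) simp
  then have "T * \<phi> u / T \<le> u * \<phi> T / T"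
    by (rule divide_right_mono_ennreal)
  then have "\<phi> u \<le> \<phi> T * (u / T)"
    using ennreal_mult_divide_cancel[OF T, of "\<phi> u"] by (simp add: ennreal_times_divide mult.commute[of "\<phi> T"])
  also have "\<dots> \<le> \<phi> T * (1 + u / T)"
    by (rule mult_left_mono) auto
  finally show ?thesis .
qed

text \<open>Write \<open>g = \<Sum> 2\<^sup>-\<^sup>k\<^sup>-\<^sup>1 \<chi>(D k)\<close> with the sets \<open>D k\<close> of points at which a binary digit is \<open>1\<close>. The bound
for \<open>\<phi>\<close> is affine in the measure, so the measures of the \<open>D k\<close> add up to the integral of \<open>g\<close>.\<close>

lemma norm_le_fundamental_affine:
  assumes m: "0 < emeasure M (space M)" and g[measurable]: "g \<in> borel_measurable M"
    and le1: "\<And>x. g x \<le> 1" and T: "0 < T" "T < \<infinity>"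
  shows "\<rho> g \<le> \<phi> T * (1 + (\<integral>\<^sup>+x. g x \<partial>M) / T)"
proof -
  define D where "D k = {x \<in> space M. (1/2) ^ Suc k \<le> binary_remainder k (enn2real (g x))}" for k
  define h where "h k = ennreal ((1/2) ^ Suc k)" for k
  have D[measurable]: "D k \<in> sets M" for k
    unfolding D_def by measurable
  have gD: "g x = (\<Sum>k. h k * indicator (D k) x)" if "x \<in> space M" for x
  proof -
    define y where "y = enn2real (g x)"
    have g_eq: "g x = ennreal y"
      using le1[of x] by (cases "g x") (auto simp: y_def top_unique)
    have "0 \<le> y"
      by (simp add: y_def)
    moreover have "y \<le> 1"
      using le1[of x] unfolding g_eq by simp
    ultimately have y: "0 \<le> y" "y \<le> 1" .
    have "(\<Sum>k. ennreal ((1/2) ^ Suc k * of_bool ((1/2) ^ Suc k \<le> binary_remainder k y))) = ennreal y"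
      by (rule suminf_ennreal_eq[OF _ binary_expansion_sums[OF y]]) simp
    moreover have "ennreal ((1/2) ^ Suc k * of_bool ((1/2) ^ Suc k \<le> binary_remainder k y)) = h k * indicator (D k) x" for k
      using that by (simp add: h_def D_def y_def indicator_def del: power_Suc)
    ultimately show ?thesis
      using g_eq by simp
  qed
  have "\<rho> g \<le> \<rho> (\<lambda>x. \<Sum>k. h k * indicator (D k) x)"
  proof (rule norm_mono[OF g])
    show "g x \<le> (\<Sum>k. h k * indicator (D k) x)" if "x \<in> space M" for x
      unfolding gD[OF that] by (rule order_refl)
  qed measurable
  also have "\<dots> \<le> (\<Sum>k. \<rho> (\<lambda>x. h k * indicator (D k) x))"
    by (rule norm_suminf_le) measurable
  also have "(\<lambda>k. \<rho> (\<lambda>x. h k * indicator (D k) x)) = (\<lambda>k. h k * \<phi> (emeasure M (D k)))"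
  proof
    fix k
    have "h k < \<infinity>"
      by (simp add: h_def)
    then show "\<rho> (\<lambda>x. h k * indicator (D k) x) = h k * \<phi> (emeasure M (D k))"
      using norm_cmult[of "indicator (D k)" "h k"] norm_indicator[OF D] by simp
  qed
  also have "(\<Sum>k. h k * \<phi> (emeasure M (D k))) \<le> (\<Sum>k. h k * (\<phi> T * (1 + emeasure M (D k) / T)))"
    by (intro suminf_le mult_left_mono fundamental_le_affine[OF m T] summableI zero_le)
  also have "(\<lambda>k. h k * (\<phi> T * (1 + emeasure M (D k) / T))) = (\<lambda>k. \<phi> T * (h k + h k * emeasure M (D k) / T))"
    by (simp add: fun_eq_iff divide_ennreal_def distrib_left mult.assoc mult.left_commute mult.commute[of "h _" "\<phi> T"])
  also have "(\<Sum>k. \<phi> T * (h k + h k * emeasure M (D k) / T)) = \<phi> T * (\<Sum>k. h k + h k * emeasure M (D k) / T)"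
    by (rule ennreal_suminf_cmult)
  also have "(\<Sum>k. h k + h k * emeasure M (D k) / T) = (\<Sum>k. h k) + (\<Sum>k. h k * emeasure M (D k) / T)"
    by (rule suminf_add[symmetric]) auto
  also have "(\<Sum>k. h k * emeasure M (D k) / T) = (\<Sum>k. h k * emeasure M (D k)) / T"
    by (rule ennreal_suminf_divide)
  also have "(\<Sum>k. h k) = 1"
    unfolding h_def by (rule suminf_half_powers)
  also have "(\<Sum>k. h k * emeasure M (D k)) = (\<integral>\<^sup>+x. (\<Sum>k. h k * indicator (D k) x) \<partial>M)"
    by (subst nn_integral_suminf) (auto simp: nn_integral_cmult_indicator)
  also have "\<dots> = (\<integral>\<^sup>+x. g x \<partial>M)"
    by (rule nn_integral_cong[OF gD[symmetric]])
  finally show ?thesis .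
qed

end

section \<open>The fundamental Young function\<close>

context nonatomic_ri_norm
begin

definition fundamental_young :: "ennreal \<Rightarrow> ennreal" where
  "fundamental_young \<tau> = Inf {s. \<tau> \<le> 1 / \<phi> (1 / s)}"

text \<open>The map \<open>s \<mapsto> 1 / \<phi> (1 / s)\<close> is non-decreasing and right-continuous; therefore the infimum is attained,
and the map is the right inverse of \<open>fundamental_young\<close>.\<close>

lemma fundamental_young_le_iff:
  assumes m: "0 < emeasure M (space M)"
  shows "fundamental_young \<tau> \<le> s \<longleftrightarrow> \<tau> \<le> 1 / \<phi> (1 / s)"
proof
  assume "\<tau> \<le> 1 / \<phi> (1 / s)"
  then show "fundamental_young \<tau> \<le> s"
    unfolding fundamental_young_def by (auto intro: Inf_lower)
next
  assume "fundamental_young \<tau> \<le> s"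
  then have above: "\<phi> (1 / s') \<le> 1 / \<tau>" if "s < s'" for s'
  proof -
    have "fundamental_young \<tau> < s'"
      using \<open>fundamental_young \<tau> \<le> s\<close> that by simp
    then obtain v where v: "v < s'" "\<tau> \<le> 1 / \<phi> (1 / v)"
      unfolding fundamental_young_def by (auto simp: Inf_less_iff)
    have "\<phi> (1 / s') \<le> \<phi> (1 / v)"
      using v by (intro fundamental_mono one_divide_antimono_ennreal) simp
    also have "\<dots> \<le> 1 / \<tau>"
      using v by (simp add: le_one_divide_iff_ennreal)
    finally show ?thesis .
  qed
  (* phi (1 / s) is the limit of phi (1 / s') as s' decreases to s: at s = 0 this is the Fatou
     property, and for 0 < s < infinity it follows from quasi-concavity. *)
  have "\<phi> (1 / s) \<le> 1 / \<tau>"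
  proof -
    consider "s = 0" | "s = \<infinity>" | "0 < s" "s < \<infinity>"
      by (cases "s = 0"; cases "s = \<infinity>") (auto simp: zero_less_iff_neq_zero less_top[symmetric])
    then show ?thesis
    proof cases
      case 1
      have "\<phi> \<infinity> \<le> 1 / \<tau>"
      proof (rule fundamental_top_le)
        fix u :: ennreal assume "u < \<infinity>"
        then have "0 < 1 / u"
          by (simp add: ennreal_zero_less_divide)
        then show "\<phi> u \<le> 1 / \<tau>"
          using above[of "1 / u"] 1 by simp
      qed
      then show ?thesis using 1 by simp
    next
      case 2
      then show ?thesis by (simp add: fundamental_zero)
    next
      case 3
      define t where "t = 1 / s"
      have t: "0 < t" "t < \<infinity>"
        unfolding t_def using one_divide_pos_finite[OF 3] by auto
      have st: "s = 1 / t"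
        by (simp add: t_def)
      show ?thesis
        unfolding t_def[symmetric]
      proof (rule ennreal_approx_unit)
        fix \<theta> :: ennreal assume \<theta>: "0 < \<theta>" "\<theta> < 1"
        have "\<theta> * t < t"
          using ennreal_mult_strict_right_mono[OF \<theta>(2) t(1)] t(2) by simp
        have "s < 1 / (\<theta> * t)"
          unfolding st using \<open>\<theta> * t < t\<close> one_divide_le_iff_ennreal[of "\<theta> * t" "1 / t"] by (simp add: not_le[symmetric])
        then have "\<phi> (\<theta> * t) \<le> 1 / \<tau>"
          using above[of "1 / (\<theta> * t)"] by simp
        have "\<theta> * t * \<phi> t \<le> t * \<phi> (\<theta> * t)"
          using \<open>\<theta> * t < t\<close> by (intro fundamental_quasi_concave m) simp
        then have "t * (\<theta> * \<phi> t) \<le> t * \<phi> (\<theta> * t)"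
          by (simp add: mult_ac)
        then have "\<theta> * \<phi> t \<le> \<phi> (\<theta> * t)"
          using t by (subst (asm) ennreal_mult_le_mult_iff) auto
        then show "\<theta> * \<phi> t \<le> 1 / \<tau>"
          using \<open>\<phi> (\<theta> * t) \<le> 1 / \<tau>\<close> by simp
      qed
    qed
  qed
  then show "\<tau> \<le> 1 / \<phi> (1 / s)"
    by (simp add: le_one_divide_iff_ennreal)
qed

lemma right_inverse_fundamental_young:
  assumes m: "0 < emeasure M (space M)"
  shows "right_inverse fundamental_young s = 1 / \<phi> (1 / s)"
  unfolding right_inverse_def fundamental_young_le_iff[OF m] by (simp add: atMost_def[symmetric])

text \<open>Star-shapedness is quasi-concavity of \<open>\<phi>\<close> read through the Galois connection.\<close>

lemma quasi_convex_fundamental_young: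
  assumes m: "0 < emeasure M (space M)"
  shows "quasi_convex fundamental_young"
proof (rule quasi_convexI[where ?t1.0 = \<infinity> and ?t2.0 = "1 / \<phi> 1"])
  note iff = fundamental_young_le_iff[OF m]
  show "star_shaped fundamental_young"
    unfolding star_shaped_def
  proof (intro allI impI)
    fix \<theta> t :: ennreal
    assume \<theta>: "\<theta> \<le> 1"
    show "fundamental_young (\<theta> * t) \<le> \<theta> * fundamental_young t"
    proof (cases "\<theta> = 0")
      case True
      have "fundamental_young 0 \<le> 0"
        unfolding iff by simp
      then show ?thesis using True by simp
    next
      case False
      define s where "s = fundamental_young t"
      have \<theta>': "0 < \<theta>" "\<theta> < \<infinity>"
        using False \<theta> by (auto simp: zero_less_iff_neq_zero intro: le_less_trans)
      have t: "t \<le> 1 / \<phi> (1 / s)"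
        unfolding s_def using iff[of t "fundamental_young t"] by simp
      have u: "1 / (\<theta> * s) = 1 / s / \<theta>"
        using \<theta>' by (simp add: divide_ennreal_def ennreal_inverse_mult' mult.commute)
      define w where "w = 1 / s"
      have "\<theta> * \<phi> (w / \<theta>) \<le> \<phi> w"
      proof -
        consider "w = 0" | "w = \<infinity>" | "0 < w" "w < \<infinity>"
          by (cases "w = 0"; cases "w = \<infinity>") (auto simp: zero_less_iff_neq_zero less_top[symmetric])
        then show ?thesis
        proof cases
          case 1
          then show ?thesis by (simp add: fundamental_zero)
        next
          case 2
          then show ?thesis
            using \<theta>' mult_right_mono[OF \<theta>, of "\<phi> \<infinity>"] by (auto simp: ennreal_top_divide)
        next
          case 3
          have "w \<le> w / \<theta>"
            using mult_left_mono[OF one_divide_antimono_ennreal[OF \<theta>], of w]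
            by (simp add: ennreal_times_divide divide_ennreal_def)
          then have "w * \<phi> (w / \<theta>) \<le> w / \<theta> * \<phi> w"
            by (rule fundamental_quasi_concave[OF m])
          then have "\<theta> * (w * \<phi> (w / \<theta>)) \<le> \<theta> * (w / \<theta> * \<phi> w)"
            by (rule mult_left_mono) simp
          also have "\<dots> = w * \<phi> w"
            using ennreal_mult_divide_cancel[OF \<theta>', of w] by (simp add: mult.assoc[symmetric])
          finally have "w * (\<theta> * \<phi> (w / \<theta>)) \<le> w * \<phi> w"
            by (simp add: mult_ac)
          then show ?thesis
            using 3 by (subst (asm) ennreal_mult_le_mult_iff) auto
        qed
      qed
      also have "\<phi> w \<le> 1 / t"
        using t unfolding w_def by (simp add: le_one_divide_iff_ennreal)
      finally have "\<theta> * \<phi> (w / \<theta>) / \<theta> \<le> 1 / t / \<theta>"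
        by (rule divide_right_mono_ennreal)
      then have "\<phi> (w / \<theta>) \<le> 1 / t / \<theta>"
        using ennreal_mult_divide_cancel[OF \<theta>', of "\<phi> (w / \<theta>)"] by (simp add: ennreal_times_divide)
      also have "\<dots> = 1 / (\<theta> * t)"
        using \<theta>' by (simp add: divide_ennreal_def ennreal_inverse_mult' mult.commute)
      finally show ?thesis
        unfolding iff s_def[symmetric] u w_def by (simp add: le_one_divide_iff_ennreal)
    qed
  qed
  show "mono fundamental_young"
    unfolding mono_def iff by (meson iff order_refl order_trans)
  show "fundamental_young t \<le> (SUP s\<in>{..<t}. fundamental_young s)" if "0 < t" for t
    unfolding iff
  proof (rule dense_le)
    fix s assume "s < t"
    then have "fundamental_young s \<le> (SUP s\<in>{..<t}. fundamental_young s)"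
      by (auto intro: SUP_upper)
    then show "s \<le> 1 / \<phi> (1 / (SUP s\<in>{..<t}. fundamental_young s))"
      by (simp only: iff)
  qed
  show "fundamental_young \<infinity> \<noteq> 0"
    using iff[of \<infinity> 0] fundamental_pos[OF m, of \<infinity>] by (auto simp: top_unique ennreal_divide_eq_top_iff)
  show "0 < 1 / \<phi> 1"
    using fundamental_finite[of 1] by (simp add: ennreal_zero_less_divide)
  show "fundamental_young (1 / \<phi> 1) \<noteq> \<infinity>"
    using iff[of "1 / \<phi> 1" 1] by (auto simp: top_unique divide_ennreal_def)
qed

lemma fundamental_orlicz_space_eq:
  assumes m: "0 < emeasure M (space M)"
  shows "fundamental_orlicz_space M \<rho> = orlicz_space M fundamental_young"
proof -
  have "inverse_sharp fundamental_young = \<phi>"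
    by (auto simp: inverse_sharp_def right_inverse_fundamental_young[OF m])
  then have "(THE A. quasi_convex A \<and> inverse_sharp A = \<phi>) = fundamental_young"
    using quasi_convex_fundamental_young[OF m] quasi_convex_eq_if_inverse_sharp_eq
    by (intro the_equality) auto
  then show ?thesis
    by (simp add: fundamental_orlicz_space_def)
qed

lemma ri_space_contains_bump_series:
  assumes m: "0 < emeasure M (space M)"
  shows "contains_bump_series M (ri_space M \<rho>) fundamental_young"
  unfolding contains_bump_series_def
proof (intro allI impI)
  fix E :: "nat \<Rightarrow> 'a set"
  assume E: "\<forall>n. E n \<in> sets M \<and> 0 < emeasure M (E n) \<and> emeasure M (E n) < \<infinity>"
  then have E'[measurable]: "\<And>n. E n \<in> sets M" by blast
  define r where "r n = right_inverse fundamental_young (1 / emeasure M (E n))" for n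
  define a where "a n = ennreal ((1/2) ^ Suc n) * r n" for n
  have r: "r n = 1 / \<phi> (emeasure M (E n))" for n
    by (simp add: r_def right_inverse_fundamental_young[OF m])
  have a: "a n < \<infinity>" "a n * \<phi> (emeasure M (E n)) = ennreal ((1/2) ^ Suc n)" for n
  proof -
    let ?p = "\<phi> (emeasure M (E n))"
    have p: "0 < ?p" "?p < \<infinity>"
      using fundamental_pos[OF m] fundamental_finite E by auto
    show "a n < \<infinity>"
      using one_divide_pos_finite[OF p] by (simp add: a_def r ennreal_mult_less_top)
    have "?p * (1 / ?p) = 1"
      by (rule ennreal_mult_divide_cancel[OF p])
    then show "a n * ?p = ennreal ((1/2) ^ Suc n)"
      unfolding a_def r by (metis mult.assoc mult.commute mult.right_neutral)
  qed
  have "\<rho> (\<lambda>x. SUP n. a n * indicator (E n) x) \<le> \<rho> (\<lambda>x. \<Sum>n. a n * indicator (E n) x)"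
  proof (rule norm_mono)
    fix x
    show "(SUP n. a n * indicator (E n) x) \<le> (\<Sum>n. a n * indicator (E n) x)"
    proof (rule SUP_least)
      fix n
      have "(\<Sum>k\<in>{n}. a k * indicator (E k) x) \<le> (\<Sum>n. a n * indicator (E n) x)"
        by (rule sum_le_suminf) auto
      then show "a n * indicator (E n) x \<le> (\<Sum>n. a n * indicator (E n) x)"
        by (simp only: sum.empty sum.insert finite.emptyI empty_iff not_False_eq_True add_0_right)
    qed
  qed measurable
  also have "\<dots> \<le> (\<Sum>n. \<rho> (\<lambda>x. a n * indicator (E n) x))"
    by (rule norm_suminf_le) measurable
  also have "(\<lambda>n. \<rho> (\<lambda>x. a n * indicator (E n) x)) = (\<lambda>n. ennreal ((1/2) ^ Suc n))"
    using a by (subst norm_cmult) (auto simp: norm_indicator simp del: power_Suc)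
  also have "(\<Sum>n. ennreal ((1/2) ^ Suc n)) < \<infinity>"
    unfolding suminf_half_powers by simp
  finally show "(\<lambda>x. enn2ereal (SUP n. ennreal ((1/2) ^ Suc n) * right_inverse fundamental_young (1 / emeasure M (E n)) * indicator (E n) x))
      \<in> ri_space M \<rho>"
    unfolding ri_space_def r_def[symmetric] a_def[symmetric] by (simp add: enn2ereal_comp_measurable)
qed

lemma ri_space_controls_bumps:
  assumes m: "0 < emeasure M (space M)"
  shows "controls_bumps M (ri_space M \<rho>) fundamental_young"
  unfolding controls_bumps_def
proof
  fix f assume "f \<in> ri_space M \<rho>"
  then have f[measurable]: "f \<in> borel_measurable M" and fin: "\<rho> (abs_fun f) < \<infinity>"
    by (auto simp: ri_space_def)
  show "\<exists>l<\<infinity>. \<forall>E a. E \<in> sets M \<longrightarrow> 0 < emeasure M E \<longrightarrow> emeasure M E < \<infinity> \<longrightarrow> a < \<infinity> \<longrightarrow>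
      (\<forall>x\<in>E. a \<le> abs_fun f x) \<longrightarrow> a \<le> l * right_inverse fundamental_young (1 / emeasure M E)"
  proof (intro exI[of _ "\<rho> (abs_fun f)"] conjI allI impI fin)
    fix E a
    assume E[measurable]: "E \<in> sets M" and E': "0 < emeasure M E" "emeasure M E < \<infinity>" and a: "a < \<infinity>" "\<forall>x\<in>E. a \<le> abs_fun f x"
    let ?p = "\<phi> (emeasure M E)"
    have p: "0 < ?p" "?p < \<infinity>"
      using fundamental_pos[OF m] fundamental_finite E' by auto
    have "a * ?p = \<rho> (\<lambda>x. a * indicator E x)"
      using a by (subst norm_cmult) (auto simp: norm_indicator)
    also have "\<dots> \<le> \<rho> (abs_fun f)"
      using a by (intro norm_mono) (auto simp: indicator_def)
    finally have "a * ?p / ?p \<le> \<rho> (abs_fun f) / ?p"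
      by (rule divide_right_mono_ennreal)
    then show "a \<le> \<rho> (abs_fun f) * right_inverse fundamental_young (1 / emeasure M E)"
      using p ennreal_mult_divide_cancel[OF p, of a]
      by (simp add: right_inverse_fundamental_young[OF m] ennreal_times_divide mult.commute)
  qed
qed

end

section \<open>Strictly smaller and strictly larger Orlicz spaces\<close>

context nonatomic_ri_norm
begin

text \<open>With \<open>c = K / \<phi>(t)\<close> the set \<open>E\<close> where \<open>g\<close> exceeds \<open>c\<close> satisfies \<open>c \<phi>(\<mu> E) \<le> 1 < c \<phi>(t)\<close>, so its
measure is at most \<open>t\<close>. Hoelder's inequality on a superset of measure exactly \<open>t\<close> bounds the integral of
\<open>g\<close> over \<open>E\<close> by \<open>t / \<phi>(t) = t c / K\<close>.\<close>

lemma integral_large_values_le: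
  assumes m: "0 < emeasure M (space M)" and g[measurable]: "g \<in> borel_measurable M" and g1: "\<rho> g \<le> 1"
    and t: "0 < t" "t < \<infinity>" "t \<le> emeasure M (space M)" and K: "1 < K" "K < \<infinity>"
  shows "(\<integral>\<^sup>+x. g x / (t * (K / \<phi> t)) * indicator {x \<in> space M. K / \<phi> t < g x} x \<partial>M) \<le> 1 / K"
proof -
  define p where "p = \<phi> t"
  have p: "0 < p" "p < \<infinity>"
    using fundamental_pos[OF m t(1)] fundamental_finite[OF t(2)] by (auto simp: p_def)
  have K0: "0 < K"
    using K by (auto intro: less_trans[OF zero_less_one])
  define c where "c = K / p"
  have cp: "c * p = K"
    using ennreal_mult_divide_cancel[OF p, of K] by (simp add: c_def ennreal_divide_times ennreal_times_divide mult.commute)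
  have c: "0 < c" "c < \<infinity>"
    using K K0 p by (auto simp: c_def ennreal_zero_less_divide ennreal_divide_eq_top_iff less_top[symmetric])
  define E where "E = {x \<in> space M. c < g x}"
  have E[measurable]: "E \<in> sets M"
    unfolding E_def by measurable
  have "c * \<phi> (emeasure M E) = \<rho> (\<lambda>x. c * indicator E x)"
    using norm_cmult[of "indicator E" c] c norm_indicator[OF E] by simp
  also have "\<dots> \<le> \<rho> g"
    by (rule norm_mono) (auto simp: E_def indicator_def)
  finally have small: "c * \<phi> (emeasure M E) \<le> 1"
    using g1 by simp
  have "emeasure M E \<le> t"
  proof (rule ccontr)
    assume "\<not> emeasure M E \<le> t"
    then have "p \<le> \<phi> (emeasure M E)"
      unfolding p_def by (intro fundamental_mono) simp
    then have "c * p \<le> 1"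
      using small mult_left_mono[of p "\<phi> (emeasure M E)" c] by (meson order_trans zero_le)
    then show False
      using K(1) cp by simp
  qed
  then obtain F where F[measurable]: "F \<in> sets M" and "E \<subseteq> F" "emeasure M F = t"
    using nonatomic_superset_of_measure[OF nonatomic E _ t(3)] by blast
  have "(\<integral>\<^sup>+x\<in>E. g x \<partial>M) \<le> (\<integral>\<^sup>+x\<in>F. g x \<partial>M)"
    using \<open>E \<subseteq> F\<close> by (intro nn_integral_mono) (auto simp: indicator_def)
  then have "(\<integral>\<^sup>+x\<in>E. g x \<partial>M) * p \<le> (\<integral>\<^sup>+x\<in>F. g x \<partial>M) * p"
    by (rule mult_right_mono) simp
  also have "\<dots> \<le> t * \<rho> g"
    using integral_times_fundamental_le[OF g F] \<open>emeasure M F = t\<close> t by (simp add: p_def)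
  also have "\<dots> \<le> t * 1"
    using g1 by (rule mult_left_mono) simp
  finally have holder: "p * (\<integral>\<^sup>+x\<in>E. g x \<partial>M) \<le> t"
    by (simp add: mult.commute)
  have "(\<integral>\<^sup>+x. g x / (t * c) * indicator E x \<partial>M) = (\<integral>\<^sup>+x. inverse (t * c) * (g x * indicator E x) \<partial>M)"
    by (simp add: divide_ennreal_def mult_ac)
  also have "\<dots> = inverse (t * c) * (\<integral>\<^sup>+x\<in>E. g x \<partial>M)"
    by (rule nn_integral_cmult) measurable
  finally have int: "(\<integral>\<^sup>+x. g x / (t * c) * indicator E x \<partial>M) = inverse (t * c) * (\<integral>\<^sup>+x\<in>E. g x \<partial>M)" .
  have "t * c * (K * (inverse (t * c) * (\<integral>\<^sup>+x\<in>E. g x \<partial>M))) = K * (\<integral>\<^sup>+x\<in>E. g x \<partial>M)"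
  proof -
    have tc: "0 < t * c" "t * c < \<infinity>"
      using t c by (auto simp: ennreal_zero_less_mult_iff ennreal_mult_less_top)
    have "t * c * (K * (inverse (t * c) * (\<integral>\<^sup>+x\<in>E. g x \<partial>M))) = t * c * (K * (\<integral>\<^sup>+x\<in>E. g x \<partial>M) / (t * c))"
      by (simp add: divide_ennreal_def mult_ac)
    also have "\<dots> = K * (\<integral>\<^sup>+x\<in>E. g x \<partial>M)"
      by (rule ennreal_mult_divide_cancel[OF tc])
    finally show ?thesis .
  qed
  also have "\<dots> = c * (p * (\<integral>\<^sup>+x\<in>E. g x \<partial>M))"
    by (simp add: cp[symmetric] mult.assoc)
  also have "\<dots> \<le> c * t"
    by (rule mult_left_mono[OF holder]) simp
  also have "\<dots> = t * c * 1"
    by (simp add: mult.commute)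
  finally have "K * (inverse (t * c) * (\<integral>\<^sup>+x\<in>E. g x \<partial>M)) \<le> 1"
    using t c by (subst (asm) ennreal_mult_le_mult_iff) (auto simp: ennreal_mult_eq_top_iff)
  then have "K * (inverse (t * c) * (\<integral>\<^sup>+x\<in>E. g x \<partial>M)) / K \<le> 1 / K"
    by (rule divide_right_mono_ennreal)
  moreover have "K * (inverse (t * c) * (\<integral>\<^sup>+x\<in>E. g x \<partial>M)) / K = inverse (t * c) * (\<integral>\<^sup>+x\<in>E. g x \<partial>M)"
    using ennreal_mult_divide_cancel[OF K0 K(2)] by (metis ennreal_times_divide)
  ultimately have "inverse (t * c) * (\<integral>\<^sup>+x\<in>E. g x \<partial>M) \<le> 1 / K"
    by simp
  then show ?thesis
    unfolding int[symmetric] by (simp add: c_def p_def E_def)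
qed

text \<open>The new Young function exceeds \<open>A\<close> just enough at the levels \<open>c n\<close> to separate the fundamental functions
along \<open>t n\<close>, while on the unit ball of the r.i. space the added terms have integrals at most
\<open>1 / K n\<close>.\<close>

lemma exists_larger_young_function:
  assumes m: "0 < emeasure M (space M)" and A: "quasi_convex A" and sub: "ri_space M \<rho> \<subseteq> orlicz_space M A"
    and nle: "\<not> fundamental_dominates M A fundamental_young"
  shows "\<exists>B. quasi_convex B \<and> ri_space M \<rho> \<subseteq> orlicz_space M B \<and> \<not> fundamental_dominates M A B"
proof -
  obtain t where t: "\<And>n::nat. 0 < t n" "\<And>n. t n < \<infinity>" "\<And>n. t n \<le> emeasure M (space M)"
    and less: "\<And>n. ennreal (4 ^ Suc n) * right_inverse fundamental_young (1 / t n) < right_inverse A (1 / t n)"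
    using not_fundamental_dominates_witness[OF nle] by blast
  (* K n is the square root of the factor 4 ^ Suc n by which the comparison fails: one half of the factor
     pays for the summability of 1 / K n, the other half is left to separate A from B. *)
  define K :: "nat \<Rightarrow> ennreal" where "K n = ennreal (2 ^ Suc n)" for n
  have K: "1 < K n" "K n < \<infinity>" "0 < K n" for n
    unfolding K_def by (auto simp: one_less_power ennreal_less_iff simp del: power_Suc)
  have sumK: "(\<Sum>n. 1 / K n) = 1"
    unfolding K_def by (rule suminf_inverse_powers_of_two)
  define c where "c n = K n / \<phi> (t n)" for n
  have c_eq: "c n = K n * right_inverse fundamental_young (1 / t n)" for n
    by (simp add: c_def right_inverse_fundamental_young[OF m] ennreal_times_divide)
  have ph: "0 < \<phi> (t n)" "\<phi> (t n) < \<infinity>" for n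
    using fundamental_pos[OF m t(1)] fundamental_finite[OF t(2)] by auto
  have c: "0 < c n" "c n < \<infinity>" for n
    using K[of n] ph[of n] by (auto simp: c_def ennreal_zero_less_divide ennreal_divide_eq_top_iff less_top[symmetric])
  define J where "J n \<tau> = \<tau> / (t n * c n) * indicator {c n<..} \<tau>" for n \<tau>
  define B0 where "B0 \<tau> = A \<tau> + (\<Sum>n. J n \<tau>)" for \<tau>
  have J_mono: "J n x \<le> J n y" if "x \<le> y" for n x y
    using that by (auto simp: J_def indicator_def intro: divide_right_mono_ennreal)
  have mono: "mono B0"
    unfolding B0_def mono_def
    by (auto intro!: add_mono quasi_convex_mono[OF A] suminf_le J_mono)
  have star: "star_shaped B0"
    unfolding star_shaped_def
  proof (intro allI impI)
    fix \<theta> \<tau> :: ennreal assume \<theta>: "\<theta> \<le> 1"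
    have "\<theta> * \<tau> \<le> \<tau>"
      using mult_right_mono[OF \<theta>, of \<tau>] by simp
    then have "J n (\<theta> * \<tau>) \<le> \<theta> * J n \<tau>" for n
      by (auto simp: J_def indicator_def ennreal_times_divide)
    then have "(\<Sum>n. J n (\<theta> * \<tau>)) \<le> (\<Sum>n. \<theta> * J n \<tau>)"
      by (intro suminf_le) auto
    then show "B0 (\<theta> * \<tau>) \<le> \<theta> * B0 \<tau>"
      unfolding B0_def distrib_left
      by (intro add_mono star_shapedD[OF quasi_convex_star_shaped[OF A] \<theta>]) simp
  qed
  note [measurable] = mono_ennreal_measurable[OF mono] quasi_convex_measurable[OF A]
  have modular: "\<exists>l. 0 < l \<and> l < \<infinity> \<and> (\<integral>\<^sup>+x. B0 (abs_fun f x / l) \<partial>M) \<le> 2" if f: "f \<in> ri_space M \<rho>" for f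
  proof -
    obtain l1 where [measurable]: "f \<in> borel_measurable M" and l1: "0 < l1" "l1 < \<infinity>"
      and int1: "(\<integral>\<^sup>+x. A (abs_fun f x / l1) \<partial>M) \<le> 1"
      using orlicz_spaceD[OF subsetD[OF sub f]] by blast
    have fin: "\<rho> (abs_fun f) < \<infinity>"
      using f by (simp add: ri_space_def)
    define l where "l = max l1 (\<rho> (abs_fun f))"
    have l: "0 < l" "l < \<infinity>" "l1 \<le> l" "\<rho> (abs_fun f) \<le> l"
      using l1 fin by (auto simp: l_def max_def)
    define g where "g x = abs_fun f x / l" for x
    have [measurable]: "g \<in> borel_measurable M"
      unfolding g_def[abs_def] by measurable
    have "\<rho> g = 1 / l * \<rho> (abs_fun f)"
      using norm_cmult[of "abs_fun f" "1 / l"] one_divide_pos_finite[OF l(1,2)]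
      by (simp add: g_def[abs_def] divide_ennreal_def mult.commute)
    also have "\<dots> \<le> 1 / l * l"
      by (rule mult_left_mono[OF l(4)]) simp
    also have "\<dots> = 1"
      using ennreal_mult_divide_cancel[OF l(1,2), of 1] by (simp add: mult.commute)
    finally have g1: "\<rho> g \<le> 1" .
    have "(\<integral>\<^sup>+x. A (g x) \<partial>M) \<le> (\<integral>\<^sup>+x. A (abs_fun f x / l1) \<partial>M)"
    proof (intro nn_integral_mono quasi_convex_mono[OF A])
      show "g x \<le> abs_fun f x / l1" for x
        using mult_left_mono[OF one_divide_antimono_ennreal[OF l(3)], of "abs_fun f x"]
        by (simp add: g_def divide_ennreal_def)
    qed
    then have intA: "(\<integral>\<^sup>+x. A (g x) \<partial>M) \<le> 1"
      using int1 by simp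
    have J_meas[measurable]: "J n \<in> borel_measurable borel" for n
      by (rule mono_ennreal_measurable) (auto simp: mono_def intro: J_mono)
    have intJ: "(\<integral>\<^sup>+x. J n (g x) \<partial>M) \<le> 1 / K n" for n
    proof -
      have "(\<integral>\<^sup>+x. J n (g x) \<partial>M) =
          (\<integral>\<^sup>+x. g x / (t n * (K n / \<phi> (t n))) * indicator {x \<in> space M. K n / \<phi> (t n) < g x} x \<partial>M)"
        by (rule nn_integral_cong) (simp add: J_def c_def indicator_def)
      also have "\<dots> \<le> 1 / K n"
        by (rule integral_large_values_le[OF m _ g1 t K(1,2)]) measurable
      finally show ?thesis .
    qed
    have "(\<integral>\<^sup>+x. B0 (g x) \<partial>M) = (\<integral>\<^sup>+x. A (g x) \<partial>M) + (\<Sum>n. \<integral>\<^sup>+x. J n (g x) \<partial>M)"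
      unfolding B0_def by (subst nn_integral_add) (auto intro!: nn_integral_suminf)
    also have "\<dots> \<le> 1 + (\<Sum>n. 1 / K n)"
      by (intro add_mono intA suminf_le intJ) auto
    also have "\<dots> = 2"
      unfolding sumK by simp
    finally show ?thesis
      using l unfolding g_def by blast
  qed
  define B where "B = left_regularization B0"
  have le: "B \<tau> \<le> B0 \<tau>" for \<tau>
    unfolding B_def by (rule left_regularization_le[OF mono])
  (* B0 is finite somewhere because the indicator of a set of positive measure has finite modular. *)
  have B: "quasi_convex B"
  proof -
    obtain t1 where t1: "t1 < \<infinity>" "0 < A t1"
      using quasi_convex_finite_pos[OF A] by blast
    obtain E where E[measurable]: "E \<in> sets M" and Et: "emeasure M E = t 0"
      using nonatomic_subset_of_measure[OF nonatomic sets.top t(3)] by blast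
    have "(\<lambda>x. enn2ereal (indicator E x)) \<in> ri_space M \<rho>"
      using norm_indicator[OF E] fundamental_finite[OF t(2)] Et by (simp add: ri_space_def enn2ereal_comp_measurable)
    then obtain l where l: "0 < l" "l < \<infinity>" and int: "(\<integral>\<^sup>+x. B0 (indicator E x / l) \<partial>M) \<le> 2"
      using modular by fastforce
    have "B0 (1 / l) * t 0 = (\<integral>\<^sup>+x. B0 (1 / l) * indicator E x \<partial>M)"
      using Et by (simp add: nn_integral_cmult_indicator)
    also have "\<dots> \<le> (\<integral>\<^sup>+x. B0 (indicator E x / l) \<partial>M)"
      by (rule nn_integral_mono) (auto simp: indicator_def)
    finally have "B0 (1 / l) * t 0 \<le> 2"
      using int by simp
    then have "B0 (1 / l) \<noteq> \<infinity>"
      using t(1)[of 0] by (auto simp: ennreal_top_mult top_unique split: if_splits)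
    moreover have "B0 t1 \<noteq> 0"
      using t1 by (auto simp: B0_def)
    ultimately show ?thesis
      unfolding B_def using quasi_convex_left_regularization[OF star mono t1(1)] one_divide_pos_finite(1)[OF l] by blast
  qed
  moreover have "ri_space M \<rho> \<subseteq> orlicz_space M B"
  proof
    fix f assume f: "f \<in> ri_space M \<rho>"
    obtain l where l: "0 < l" "l < \<infinity>" and int: "(\<integral>\<^sup>+x. B0 (abs_fun f x / l) \<partial>M) \<le> 2"
      using modular[OF f] by blast
    have "(\<integral>\<^sup>+x. B (abs_fun f x / l) \<partial>M) \<le> (\<integral>\<^sup>+x. B0 (abs_fun f x / l) \<partial>M)"
      by (intro nn_integral_mono le)
    also have "\<dots> < \<infinity>"
      using int by (auto intro: le_less_trans)
    finally show "f \<in> orlicz_space M B"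
      using f l by (intro orlicz_spaceI[OF B]) (auto simp: ri_space_def)
  qed
  moreover have "\<not> fundamental_dominates M A B"
  proof
    assume "fundamental_dominates M A B"
    then obtain C where C: "C < \<infinity>" "\<And>n. right_inverse A (1 / t n) \<le> C * right_inverse B (1 / t n)"
      using t unfolding fundamental_dominates_def by blast
    have "right_inverse B (1 / t n) \<le> c n" for n
    proof (rule ccontr)
      assume "\<not> right_inverse B (1 / t n) \<le> c n"
      then obtain \<tau> where \<tau>: "c n < \<tau>" "\<tau> < right_inverse B (1 / t n)"
        using dense by (auto simp: not_le)
      have "B0 \<tau> \<le> B (right_inverse B (1 / t n))"
        unfolding B_def by (rule left_regularization_upper) (use \<tau> B_def in simp)
      also have "\<dots> \<le> 1 / t n"
        using le_right_inverse_iff[OF B] by blast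
      finally have "B0 \<tau> \<le> 1 / t n" .
      have "J n \<tau> \<le> (\<Sum>n. J n \<tau>)"
        using sum_le_suminf[of "\<lambda>n. J n \<tau>" "{n}"] by simp
      also have "\<dots> \<le> B0 \<tau>"
        by (simp add: B0_def)
      finally have "\<tau> / (t n * c n) \<le> 1 / t n"
        using \<open>B0 \<tau> \<le> 1 / t n\<close> \<tau> by (simp add: J_def)
      then have "t n * c n * (\<tau> / (t n * c n)) \<le> t n * c n * (1 / t n)"
        by (rule mult_left_mono) simp
      moreover have "t n * c n * (\<tau> / (t n * c n)) = \<tau>"
        using t[of n] c[of n] by (intro ennreal_mult_divide_cancel) (auto simp: ennreal_zero_less_mult_iff ennreal_mult_less_top)
      moreover have "t n * c n * (1 / t n) = c n"
        using ennreal_mult_divide_cancel[OF t(1,2), of n "c n"] by (simp add: ennreal_times_divide)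
      ultimately show False
        using \<tau> by simp
    qed
    then have upper: "right_inverse A (1 / t n) \<le> C * c n" for n
      using C(2)[of n] by (meson mult_left_mono order_trans zero_le)
    have "ennreal (2 ^ n) \<le> C" for n
    proof -
      define r where "r = right_inverse fundamental_young (1 / t n)"
      have r: "0 < r" "r < \<infinity>"
        unfolding r_def right_inverse_fundamental_young[OF m]
        using one_divide_pos_finite[OF ph[of n]] by auto
      have "ennreal (4 ^ Suc n) * r \<le> C * (K n * r)"
        using less[of n] upper[of n] unfolding c_eq r_def by simp
      moreover have "ennreal (4 ^ Suc n) = ennreal (2 ^ Suc n) * K n"
        unfolding K_def by (simp flip: ennreal_mult power_mult_distrib)
      ultimately have "K n * r * ennreal (2 ^ Suc n) \<le> K n * r * C"
        by (simp only: mult_ac)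
      then have "ennreal (2 ^ Suc n) \<le> C"
        using r K[of n] by (subst (asm) ennreal_mult_le_mult_iff) (auto simp: ennreal_mult_eq_top_iff)
      then show ?thesis
        by (rule order_trans[rotated]) (simp add: ennreal_leI)
    qed
    then show False
      using powers_of_two_unbounded_ennreal[OF C(1)] by blast
  qed
  ultimately show ?thesis by blast
qed

text \<open>Dually, the new Young function is lowered at the levels \<open>d n\<close>. The constants are chosen so that
\<open>G n (d n) = 1 / t n\<close> and \<open>d n * \<phi> (t n) = 1 / K n\<close>: the first separates the fundamental functions, and by
the second the parts of a function that are governed by \<open>G n\<close> have summable norms.\<close>

lemma exists_smaller_young_function:
  assumes m: "0 < emeasure M (space M)" and A: "quasi_convex A" and sub: "orlicz_space M A \<subseteq> ri_space M \<rho>"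
    and nle: "\<not> fundamental_dominates M fundamental_young A"
  shows "\<exists>B. quasi_convex B \<and> orlicz_space M B \<subseteq> ri_space M \<rho> \<and> \<not> fundamental_dominates M B A"
proof -
  obtain t where t: "\<And>n::nat. 0 < t n" "\<And>n. t n < \<infinity>" "\<And>n. t n \<le> emeasure M (space M)"
    and less: "\<And>n. ennreal (4 ^ Suc n) * right_inverse A (1 / t n) < right_inverse fundamental_young (1 / t n)"
    using not_fundamental_dominates_witness[OF nle] by blast
  note Y = quasi_convex_fundamental_young[OF m]
  define K :: "nat \<Rightarrow> ennreal" where "K n = ennreal (2 ^ Suc n)" for n
  have K: "1 < K n" "K n < \<infinity>" "0 < K n" for n
    unfolding K_def by (auto simp: one_less_power ennreal_less_iff simp del: power_Suc)
  have sumK: "(\<Sum>n. 1 / K n) = 1"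
    unfolding K_def by (rule suminf_inverse_powers_of_two)
  have ph: "0 < \<phi> (t n)" "\<phi> (t n) < \<infinity>" for n
    using fundamental_pos[OF m t(1)] fundamental_finite[OF t(2)] by auto
  define r where "r n = right_inverse fundamental_young (1 / t n)" for n
  have r_eq: "r n = 1 / \<phi> (t n)" for n
    by (simp add: r_def right_inverse_fundamental_young[OF m])
  have r: "0 < r n" "r n < \<infinity>" for n
    unfolding r_eq using one_divide_pos_finite[OF ph] by auto
  define d where "d n = r n / K n" for n
  have Kd: "K n * d n = r n" for n
    unfolding d_def by (rule ennreal_mult_divide_cancel[OF K(3,2)])
  have d: "0 < d n" "d n < \<infinity>" for n
    using r[of n] K[of n] by (auto simp: d_def ennreal_zero_less_divide ennreal_divide_eq_top_iff less_top[symmetric])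
  have dt: "0 < d n * t n" "d n * t n < \<infinity>" for n
    using d[of n] t[of n] by (auto simp: ennreal_zero_less_mult_iff ennreal_mult_less_top)
  have "d n \<le> r n" for n
    using mult_right_mono[OF less_imp_le[OF K(1)], of "d n" n] by (simp add: Kd)
  have d_phi: "d n * \<phi> (t n) = 1 / K n" for n
  proof -
    have "d n * \<phi> (t n) = \<phi> (t n) * (1 / \<phi> (t n)) * (1 / K n)"
      by (simp add: d_def r_eq divide_ennreal_def mult_ac)
    then show ?thesis
      unfolding ennreal_mult_divide_cancel[OF ph] by simp
  qed
  define G where "G n \<tau> = (if \<tau> \<le> d n then \<tau> / (d n * t n) else \<infinity>)" for n \<tau>
  define B0 where "B0 \<tau> = min (A \<tau>) (INF n. G n \<tau>)" for \<tau>
  have G_mono: "G n x \<le> G n y" if "x \<le> y" for n x y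
    using that by (auto simp: G_def intro: divide_right_mono_ennreal)
  have mono: "mono B0"
    unfolding B0_def by (intro monoI min.mono quasi_convex_mono[OF A] INF_mono' G_mono)
  have B0_le_A: "B0 \<tau> \<le> A \<tau>" for \<tau>
    by (simp add: B0_def)
  have B0_le_G: "B0 \<tau> \<le> G n \<tau>" for \<tau> n
    by (auto simp: B0_def intro: min.coboundedI2 INF_lower)
  have B0_zero: "B0 0 = 0"
    using B0_le_A[of 0] quasi_convex_zero[OF A] by simp
  have star: "star_shaped B0"
    unfolding star_shaped_def
  proof (intro allI impI)
    fix \<theta> \<tau> :: ennreal assume \<theta>: "\<theta> \<le> 1"
    show "B0 (\<theta> * \<tau>) \<le> \<theta> * B0 \<tau>"
    proof (cases "\<theta> = 0")
      case True
      then show ?thesis by (simp add: B0_zero)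
    next
      case False
      then have \<theta>': "0 < \<theta>" "\<theta> < \<infinity>"
        using \<theta> by (auto simp: zero_less_iff_neq_zero intro: le_less_trans)
      have le: "\<theta> * \<tau> \<le> \<tau>"
        using mult_right_mono[OF \<theta>, of \<tau>] by simp
      have "B0 (\<theta> * \<tau>) \<le> \<theta> * A \<tau>"
        using B0_le_A star_shapedD[OF quasi_convex_star_shaped[OF A] \<theta>] order_trans by blast
      then have 1: "B0 (\<theta> * \<tau>) / \<theta> \<le> A \<tau>"
        using \<theta>' by (intro divide_le_posI_ennreal) auto
      have "B0 (\<theta> * \<tau>) \<le> \<theta> * G n \<tau>" for n
      proof (cases "\<tau> \<le> d n")
        case True
        then have "G n (\<theta> * \<tau>) = \<theta> * G n \<tau>"
          using order_trans[OF le True] by (simp add: G_def ennreal_times_divide)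
        then show ?thesis
          using B0_le_G[of "\<theta> * \<tau>" n] by simp
      next
        case False
        then show ?thesis
          using \<theta>' by (simp add: G_def ennreal_mult_top)
      qed
      then have 2: "B0 (\<theta> * \<tau>) / \<theta> \<le> G n \<tau>" for n
        using \<theta>' by (intro divide_le_posI_ennreal) auto
      have "B0 (\<theta> * \<tau>) / \<theta> \<le> B0 \<tau>"
        unfolding B0_def[of \<tau>] by (intro min.boundedI 1 INF_greatest 2)
      then have "\<theta> * (B0 (\<theta> * \<tau>) / \<theta>) \<le> \<theta> * B0 \<tau>"
        by (rule mult_left_mono) simp
      then show ?thesis
        unfolding ennreal_mult_divide_cancel[OF \<theta>'] .
    qed
  qed
  (* This keeps the infimum of all G n away from zero. *)
  have Y_le_G: "fundamental_young \<tau> \<le> G n \<tau>" for \<tau> n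
  proof (cases "\<tau> \<le> d n")
    case True
    have "\<tau> / d n \<le> 1"
      using True d by (intro divide_le_posI_ennreal) auto
    then have "fundamental_young (\<tau> / d n * d n) \<le> \<tau> / d n * fundamental_young (d n)"
      by (rule star_shapedD[OF quasi_convex_star_shaped[OF Y]])
    also have "fundamental_young (d n) \<le> 1 / t n"
      using \<open>d n \<le> r n\<close> unfolding r_def le_right_inverse_iff[OF Y] .
    also have "\<tau> / d n * d n = \<tau>"
      using ennreal_mult_divide_cancel[OF d, of n \<tau>] by (simp add: mult.commute)
    also have "\<tau> / d n * (1 / t n) = G n \<tau>"
      using True d[of n] t[of n] by (simp add: G_def divide_ennreal_def ennreal_inverse_mult mult_ac)
    finally show ?thesis
      by (simp add: mult_left_mono)
  qed (simp add: G_def)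
  define B where "B = left_regularization B0"
  have le: "B \<tau> \<le> B0 \<tau>" for \<tau>
    unfolding B_def by (rule left_regularization_le[OF mono])
  have B: "quasi_convex B"
  proof -
    obtain a1 where a1: "a1 < \<infinity>" "0 < A a1"
      using quasi_convex_finite_pos[OF A] by blast
    obtain y1 where y1: "y1 < \<infinity>" "0 < fundamental_young y1"
      using quasi_convex_finite_pos[OF Y] by blast
    obtain t2 where t2: "0 < t2" "A t2 \<noteq> \<infinity>"
      using A by (auto simp: quasi_convex_def)
    define b where "b = max a1 y1"
    have b: "b < \<infinity>"
      using a1 y1 by (simp add: b_def)
    have "0 < min (A b) (fundamental_young b)"
      using less_le_trans[OF a1(2) quasi_convex_mono[OF A, of a1 b]]
        less_le_trans[OF y1(2) quasi_convex_mono[OF Y, of y1 b]] by (simp add: b_def)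
    also have "\<dots> \<le> B0 b"
      unfolding B0_def by (intro min.mono order_refl INF_greatest Y_le_G)
    finally have "B0 b \<noteq> 0" by simp
    moreover have "B0 t2 \<noteq> \<infinity>"
      using t2 B0_le_A[of t2] by (auto simp: top_unique)
    ultimately show ?thesis
      unfolding B_def using quasi_convex_left_regularization[OF star mono b _ t2(1)] by blast
  qed
  have G_meas[measurable]: "G n \<in> borel_measurable borel" for n
    by (rule mono_ennreal_measurable) (auto simp: mono_def intro: G_mono)
  note [measurable] = mono_ennreal_measurable[OF mono] quasi_convex_measurable[OF A]
  have "orlicz_space M B \<subseteq> ri_space M \<rho>"
  proof
    fix f assume "f \<in> orlicz_space M B"
    then obtain l where f[measurable]: "f \<in> borel_measurable M" and l: "0 < l" "l < \<infinity>"
      and int: "(\<integral>\<^sup>+ x. B (abs_fun f x / l) \<partial>M) \<le> 1"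
      using orlicz_spaceD by blast
    (* The factor 2 compensates the left regularization. *)
    define u where "u x = abs_fun f x / l / 2" for x
    have u[measurable]: "u \<in> borel_measurable M"
      unfolding u_def[abs_def] by measurable
    have B0_half: "B0 (y / 2) \<le> B y" for y
    proof -
      consider "y = 0" | "y = \<infinity>" | "0 < y" "y < \<infinity>"
        by (cases "y = 0"; cases "y = \<infinity>") (auto simp: zero_less_iff_neq_zero less_top[symmetric])
      then show ?thesis
      proof cases
        case 1
        then show ?thesis by (simp add: B0_zero)
      next
        case 2
        then show ?thesis using quasi_convex_top[OF B] by simp
      next
        case 3
        then have "y / 2 < y"
          by (cases y) (auto simp: ennreal_divide_numeral ennreal_less_iff)
        then show ?thesis
          unfolding B_def by (rule left_regularization_upper)
      qed
    qed
    have "(\<integral>\<^sup>+ x. B0 (u x) \<partial>M) \<le> (\<integral>\<^sup>+ x. B (abs_fun f x / l) \<partial>M)"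
      unfolding u_def by (intro nn_integral_mono B0_half)
    then have int_u: "(\<integral>\<^sup>+ x. B0 (u x) \<partial>M) \<le> 1"
      using int by simp
    (* Where v x is finite, h x > 0 gives B0 (u x) < v x. Hence A (u x) or some G n (u x) lies below v x,
       whether or not the infimum is attained. *)
    obtain h where h[measurable]: "h \<in> borel_measurable M" and h_fin: "(\<integral>\<^sup>+ x. h x \<partial>M) \<noteq> \<infinity>"
      and h_pos: "\<And>x. x \<in> space M \<Longrightarrow> 0 < h x \<and> h x < \<infinity>"
      using Ex_finite_integrable_function by blast
    define v where "v x = B0 (u x) + h x" for x
    have v[measurable]: "v \<in> borel_measurable M"
      unfolding v_def[abs_def] by measurable
    define H where "H = 1 + (\<integral>\<^sup>+ x. h x \<partial>M)"
    have H: "H < \<infinity>"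
      using h_fin by (simp add: H_def less_top)
    have int_v: "(\<integral>\<^sup>+ x. v x \<partial>M) \<le> H"
      unfolding v_def H_def using int_u by (subst nn_integral_add) (auto intro: add_right_mono)
    define S where "S n = {x \<in> space M. G n (u x) \<le> v x \<and> v x < \<infinity>}" for n
    define S' where "S' = {x \<in> space M. A (u x) \<le> v x \<and> v x < \<infinity>}"
    have [measurable]: "S n \<in> sets M" "S' \<in> sets M" for n
      unfolding S_def S'_def by measurable
    have norm_S: "\<rho> (\<lambda>x. u x * indicator (S n) x) \<le> (1 + H) * (1 / K n)" for n
    proof -
      define w where "w x = u x * indicator (S n) x / d n" for x
      have [measurable]: "w \<in> borel_measurable M"
        unfolding w_def[abs_def] by measurable
      have in_S: "u x \<le> d n" "u x / (d n * t n) \<le> v x" if "x \<in> S n" for x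
        using that by (auto simp: S_def G_def top_unique split: if_splits)
      have w1: "w x \<le> 1" for x
        using in_S(1) d[of n] by (auto simp: w_def indicator_def intro!: divide_le_posI_ennreal)
      have "w x \<le> t n * v x" for x
      proof (cases "x \<in> S n")
        case True
        have "w x = t n * (u x / d n / t n)"
          using ennreal_mult_divide_cancel[OF t(1,2), of n "u x / d n"] True by (simp add: w_def)
        also have "u x / d n / t n = u x / (d n * t n)"
          using d[of n] t[of n] by (simp add: divide_ennreal_def ennreal_inverse_mult mult_ac)
        finally show ?thesis
          using in_S(2)[OF True] by (simp add: mult_left_mono)
      qed (simp add: w_def)
      then have "(\<integral>\<^sup>+x. w x \<partial>M) \<le> (\<integral>\<^sup>+x. t n * v x \<partial>M)"
        by (intro nn_integral_mono)
      also have "\<dots> = t n * (\<integral>\<^sup>+x. v x \<partial>M)"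
        by (rule nn_integral_cmult) measurable
      also have "\<dots> \<le> t n * H"
        by (rule mult_left_mono[OF int_v]) simp
      finally have "(\<integral>\<^sup>+x. w x \<partial>M) / t n \<le> t n * H / t n"
        by (rule divide_right_mono_ennreal)
      also have "\<dots> = H"
        using ennreal_mult_divide_cancel[OF t(1,2), of n H] by (simp add: ennreal_times_divide)
      finally have int_w: "(\<integral>\<^sup>+x. w x \<partial>M) / t n \<le> H" .
      have "\<rho> w \<le> \<phi> (t n) * (1 + (\<integral>\<^sup>+x. w x \<partial>M) / t n)"
        by (rule norm_le_fundamental_affine[OF m _ w1 t(1,2)]) measurable
      also have "\<dots> \<le> \<phi> (t n) * (1 + H)"
        by (intro mult_left_mono add_left_mono int_w) simp
      finally have norm_w: "\<rho> w \<le> \<phi> (t n) * (1 + H)" .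
      have "(\<lambda>x. u x * indicator (S n) x) = (\<lambda>x. d n * w x)"
        unfolding w_def ennreal_mult_divide_cancel[OF d] ..
      then have "\<rho> (\<lambda>x. u x * indicator (S n) x) = d n * \<rho> w"
        using norm_cmult[of w "d n"] d by simp
      also have "\<dots> \<le> d n * (\<phi> (t n) * (1 + H))"
        by (rule mult_left_mono[OF norm_w]) simp
      also have "\<dots> = (1 + H) * (d n * \<phi> (t n))"
        by (simp only: mult_ac)
      finally show ?thesis
        unfolding d_phi .
    qed
    have norm_S': "\<rho> (\<lambda>x. u x * indicator S' x) < \<infinity>"
    proof -
      have "(\<integral>\<^sup>+x. A (u x * indicator S' x / 1) \<partial>M) \<le> (\<integral>\<^sup>+x. v x \<partial>M)"
        using quasi_convex_zero[OF A]
        by (intro nn_integral_mono) (auto simp: S'_def indicator_def divide_ennreal_def)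
      also have "\<dots> < \<infinity>"
        using int_v H by (rule le_less_trans)
      finally have "(\<lambda>x. enn2ereal (u x * indicator S' x)) \<in> orlicz_space M A"
        by (intro orlicz_spaceI[OF A, where l = 1] enn2ereal_comp_measurable) auto
      then show ?thesis
        using sub by (auto simp: ri_space_def)
    qed
    have "AE x in M. u x \<le> u x * indicator S' x + (\<Sum>n. u x * indicator (S n) x)"
    proof -
      have "AE x in M. v x \<noteq> \<infinity>"
        using int_v H by (intro nn_integral_PInf_AE) auto
      then show ?thesis
      proof (rule AE_mp, intro AE_I2 impI)
        fix x assume x: "x \<in> space M" and fin: "v x \<noteq> \<infinity>"
        have "B0 (u x) < v x"
          using h_pos[OF x] fin by (cases "B0 (u x)"; cases "h x") (auto simp: v_def ennreal_less_iff simp flip: ennreal_plus)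
        then consider "A (u x) < v x" | n where "G n (u x) < v x"
          unfolding B0_def by (auto simp: min_less_iff_disj INF_less_iff)
        then show "u x \<le> u x * indicator S' x + (\<Sum>n. u x * indicator (S n) x)"
        proof cases
          case 1
          then have "x \<in> S'"
            using x fin by (simp add: S'_def less_top less_imp_le)
          then show ?thesis by simp
        next
          case 2
          then have "x \<in> S n"
            using x fin by (simp add: S_def less_top less_imp_le)
          then have "u x = (\<Sum>k\<in>{n}. u x * indicator (S k) x)"
            by simp
          also have "\<dots> \<le> (\<Sum>n. u x * indicator (S n) x)"
            by (rule sum_le_suminf) auto
          finally show ?thesis
            by (rule add_increasing[OF zero_le])
        qed
      qed
    qed
    then have "\<rho> u \<le> \<rho> (\<lambda>x. u x * indicator S' x + (\<Sum>n. u x * indicator (S n) x))"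
      by (rule monotone[rotated 2]) measurable
    also have "\<dots> \<le> \<rho> (\<lambda>x. u x * indicator S' x) + \<rho> (\<lambda>x. \<Sum>n. u x * indicator (S n) x)"
      by (rule triangle) measurable
    also have "\<dots> \<le> \<rho> (\<lambda>x. u x * indicator S' x) + (\<Sum>n. \<rho> (\<lambda>x. u x * indicator (S n) x))"
      by (intro add_left_mono norm_suminf_le) measurable
    also have "\<dots> \<le> \<rho> (\<lambda>x. u x * indicator S' x) + (\<Sum>n. (1 + H) * (1 / K n))"
      by (intro add_left_mono suminf_le norm_S) auto
    also have "(\<Sum>n. (1 + H) * (1 / K n)) = 1 + H"
      unfolding ennreal_suminf_cmult sumK by simp
    also have "\<rho> (\<lambda>x. u x * indicator S' x) + (1 + H) < \<infinity>"
      using norm_S' H by simp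
    finally have "\<rho> u < \<infinity>" .
    moreover have "abs_fun f = (\<lambda>x. (l * 2) * u x)"
    proof
      fix x
      have "(l * 2) * u x = l * (2 * (abs_fun f x / l / 2))"
        by (simp only: u_def mult.assoc)
      also have "2 * (abs_fun f x / l / 2) = abs_fun f x / l"
        by (rule ennreal_mult_divide_cancel) auto
      also have "l * \<dots> = abs_fun f x"
        by (rule ennreal_mult_divide_cancel[OF l])
      finally show "abs_fun f x = (l * 2) * u x" ..
    qed
    then have "\<rho> (abs_fun f) = (l * 2) * \<rho> u"
      using norm_cmult[OF u, of "l * 2"] l by (simp add: ennreal_mult_less_top)
    ultimately show "f \<in> ri_space M \<rho>"
      using l by (simp add: ri_space_def ennreal_mult_less_top)
  qed
  moreover have "\<not> fundamental_dominates M B A"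
  proof
    assume "fundamental_dominates M B A"
    then obtain C where C: "C < \<infinity>" "\<And>n. right_inverse B (1 / t n) \<le> C * right_inverse A (1 / t n)"
      using t unfolding fundamental_dominates_def by blast
    have "ennreal (2 ^ n) \<le> C" for n
    proof -
      define a where "a = right_inverse A (1 / t n)"
      have a: "0 < a" "a < \<infinity>"
        unfolding a_def using right_inverse_pos[OF A] right_inverse_finite[OF A] one_divide_pos_finite[OF t(1,2)] by auto
      have "d n / (d n * t n) = 1 / t n"
        using ennreal_mult_divide_cancel[OF d, of n "1 / t n"] d[of n] t[of n]
        by (simp add: divide_ennreal_def ennreal_inverse_mult mult_ac)
      then have "B (d n) \<le> 1 / t n"
        using order_trans[OF le B0_le_G, of "d n" n] by (simp add: G_def)
      then have "d n \<le> C * a"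
        using C(2)[of n] by (simp add: le_right_inverse_iff[OF B, symmetric] a_def)
      then have "r n \<le> K n * (C * a)"
        unfolding Kd[symmetric] by (rule mult_left_mono) simp
      then have "ennreal (4 ^ Suc n) * a \<le> K n * (C * a)"
        using less[of n] unfolding r_def[symmetric] a_def[symmetric] by simp
      moreover have "ennreal (4 ^ Suc n) = ennreal (2 ^ Suc n) * K n"
        unfolding K_def by (simp flip: ennreal_mult power_mult_distrib)
      ultimately have "K n * a * ennreal (2 ^ Suc n) \<le> K n * a * C"
        by (simp only: mult_ac)
      then have "ennreal (2 ^ Suc n) \<le> C"
        using a K[of n] by (subst (asm) ennreal_mult_le_mult_iff) (auto simp: ennreal_mult_eq_top_iff)
      then show ?thesis
        by (rule order_trans[rotated]) (simp add: ennreal_leI)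
    qed
    then show False
      using powers_of_two_unbounded_ennreal[OF C(1)] by blast
  qed
  ultimately show ?thesis
    using B by blast
qed

end

section \<open>Optimal Orlicz spaces\<close>

context nonatomic_ri_norm
begin

lemma smallest_orlicz_dichotomy:
  assumes m: "0 < emeasure M (space M)"
  defines "L \<equiv> orlicz_space M fundamental_young"
  shows "(ri_space M \<rho> \<subseteq> L \<and> smallest_orlicz_space_containing M (ri_space M \<rho>) L) \<or>
    (\<not> ri_space M \<rho> \<subseteq> L \<and> (\<nexists>S. smallest_orlicz_space_containing M (ri_space M \<rho>) S))"
proof (cases "ri_space M \<rho> \<subseteq> L")
  case True
  note Y = quasi_convex_fundamental_young[OF m]
  have "L \<subseteq> L'" if L': "L' \<in> orlicz_spaces M" "ri_space M \<rho> \<subseteq> L'" for L'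
  proof -
    obtain A where A: "quasi_convex A" "L' = orlicz_space M A"
      using L'(1) by (auto simp: orlicz_spaces_def)
    have "fundamental_dominates M fundamental_young A"
      using L'(2) A fundamental_dominates_if_subset[OF nonatomic Y A(1) ri_space_contains_bump_series[OF m] orlicz_space_controls_bumps[OF A(1)]] by simp
    then show ?thesis
      unfolding L_def A(2) by (rule orlicz_space_subset_if_dominates[OF Y A(1)])
  qed
  then show ?thesis
    using True Y unfolding smallest_orlicz_space_containing_def orlicz_spaces_def L_def by blast
next
  case False
  note Y = quasi_convex_fundamental_young[OF m]
  have "\<not> smallest_orlicz_space_containing M (ri_space M \<rho>) S" for S
  proof
    assume S: "smallest_orlicz_space_containing M (ri_space M \<rho>) S"
    then obtain A where A: "quasi_convex A" "S = orlicz_space M A"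
      by (auto simp: smallest_orlicz_space_containing_def orlicz_spaces_def)
    have sub: "ri_space M \<rho> \<subseteq> orlicz_space M A"
      using S A by (simp add: smallest_orlicz_space_containing_def)
    have "\<not> fundamental_dominates M A fundamental_young"
      using orlicz_space_subset_if_dominates[OF A(1) Y] sub False unfolding L_def by blast
    then obtain B where B: "quasi_convex B" "ri_space M \<rho> \<subseteq> orlicz_space M B" "\<not> fundamental_dominates M A B"
      using exists_larger_young_function[OF m A(1) sub] by blast
    have "orlicz_space M A \<subseteq> orlicz_space M B"
      using S A B unfolding smallest_orlicz_space_containing_def orlicz_spaces_def by blast
    then show False
      using B(3) fundamental_dominates_if_subset[OF nonatomic A(1) B(1) orlicz_space_contains_bump_series[OF A(1)] orlicz_space_controls_bumps[OF B(1)]] by blast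
  qed
  then show ?thesis
    using False by blast
qed

lemma largest_orlicz_dichotomy:
  assumes m: "0 < emeasure M (space M)"
  defines "L \<equiv> orlicz_space M fundamental_young"
  shows "(L \<subseteq> ri_space M \<rho> \<and> largest_orlicz_space_contained_in M (ri_space M \<rho>) L) \<or>
    (\<not> L \<subseteq> ri_space M \<rho> \<and> (\<nexists>S. largest_orlicz_space_contained_in M (ri_space M \<rho>) S))"
proof (cases "L \<subseteq> ri_space M \<rho>")
  case True
  note Y = quasi_convex_fundamental_young[OF m]
  have "L' \<subseteq> L" if L': "L' \<in> orlicz_spaces M" "L' \<subseteq> ri_space M \<rho>" for L'
  proof -
    obtain A where A: "quasi_convex A" "L' = orlicz_space M A"
      using L'(1) by (auto simp: orlicz_spaces_def)
    have "fundamental_dominates M A fundamental_young"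
      using L'(2) A fundamental_dominates_if_subset[OF nonatomic A(1) Y orlicz_space_contains_bump_series[OF A(1)] ri_space_controls_bumps[OF m]] by simp
    then show ?thesis
      unfolding L_def A(2) by (rule orlicz_space_subset_if_dominates[OF A(1) Y])
  qed
  then show ?thesis
    using True Y unfolding largest_orlicz_space_contained_in_def orlicz_spaces_def L_def by blast
next
  case False
  note Y = quasi_convex_fundamental_young[OF m]
  have "\<not> largest_orlicz_space_contained_in M (ri_space M \<rho>) S" for S
  proof
    assume S: "largest_orlicz_space_contained_in M (ri_space M \<rho>) S"
    then obtain A where A: "quasi_convex A" "S = orlicz_space M A"
      by (auto simp: largest_orlicz_space_contained_in_def orlicz_spaces_def)
    have sub: "orlicz_space M A \<subseteq> ri_space M \<rho>"
      using S A by (simp add: largest_orlicz_space_contained_in_def)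
    have "\<not> fundamental_dominates M fundamental_young A"
      using orlicz_space_subset_if_dominates[OF Y A(1)] sub False unfolding L_def by blast
    then obtain B where B: "quasi_convex B" "orlicz_space M B \<subseteq> ri_space M \<rho>" "\<not> fundamental_dominates M B A"
      using exists_smaller_young_function[OF m A(1) sub] by blast
    have "orlicz_space M B \<subseteq> orlicz_space M A"
      using S A B unfolding largest_orlicz_space_contained_in_def orlicz_spaces_def by blast
    then show False
      using B(3) fundamental_dominates_if_subset[OF nonatomic B(1) A(1) orlicz_space_contains_bump_series[OF B(1)] orlicz_space_controls_bumps[OF A(1)]] by blast
  qed
  then show ?thesis
    using False by blast
qed

end

theorem theorem1:
  fixes M :: "'a measure"
  assumes "sigma_finite_measure M" and "nonatomic M"
  shows
    "(\<forall>\<rho>. ri_norm M \<rho> \<longrightarrow>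
        (let Y = ri_space M \<rho>; L = fundamental_orlicz_space M \<rho> in
          (Y \<subseteq> L \<and> smallest_orlicz_space_containing M Y L) \<or>
          (\<not> Y \<subseteq> L \<and> (\<nexists>S. smallest_orlicz_space_containing M Y S)))) \<and>
     (\<forall>\<rho>. ri_norm M \<rho> \<longrightarrow>
        (let X = ri_space M \<rho>; L = fundamental_orlicz_space M \<rho> in
          (L \<subseteq> X \<and> largest_orlicz_space_contained_in M X L) \<or>
          (\<not> L \<subseteq> X \<and> (\<nexists>S. largest_orlicz_space_contained_in M X S))))"
proof (cases "emeasure M (space M) = 0")
  case True
  have L: "fundamental_orlicz_space M \<rho> = borel_measurable M" for \<rho>
    unfolding fundamental_orlicz_space_def by (rule orlicz_space_null[OF True])
  have spaces: "orlicz_spaces M = {borel_measurable M}"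
    using quasi_convex_ident by (auto simp: orlicz_spaces_def orlicz_space_null[OF True])
  have "ri_space M \<rho> = borel_measurable M" if "ri_norm M \<rho>" for \<rho>
  proof -
    interpret nonatomic_ri_norm M \<rho>
      using that assms by (simp add: nonatomic_ri_norm_def nonatomic_ri_norm_axioms_def)
    show ?thesis by (rule ri_space_null[OF True])
  qed
  then show ?thesis
    by (simp add: L spaces smallest_orlicz_space_containing_def largest_orlicz_space_contained_in_def)
next
  case False
  then have m: "0 < emeasure M (space M)"
    by (simp add: zero_less_iff_neq_zero)
  show ?thesis
  proof (intro conjI allI impI)
    fix \<rho> assume "ri_norm M \<rho>"
    then interpret nonatomic_ri_norm M \<rho>
      using assms by (simp add: nonatomic_ri_norm_def nonatomic_ri_norm_axioms_def)
    show "let Y = ri_space M \<rho>; L = fundamental_orlicz_space M \<rho> in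
          (Y \<subseteq> L \<and> smallest_orlicz_space_containing M Y L) \<or>
          (\<not> Y \<subseteq> L \<and> (\<nexists>S. smallest_orlicz_space_containing M Y S))"
      unfolding Let_def fundamental_orlicz_space_eq[OF m] by (rule smallest_orlicz_dichotomy[OF m])
    show "let X = ri_space M \<rho>; L = fundamental_orlicz_space M \<rho> in
          (L \<subseteq> X \<and> largest_orlicz_space_contained_in M X L) \<or>
          (\<not> L \<subseteq> X \<and> (\<nexists>S. largest_orlicz_space_contained_in M X S))"
      unfolding Let_def fundamental_orlicz_space_eq[OF m] by (rule largest_orlicz_dichotomy[OF m])
  qed
qed

end
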